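(* Let $H$ be a separable Hilbert space, $-\infty<a<b<\infty$, and let $A_1,A_2$ be linear selfadjoint operators in $H$ with $A_1\le 0$, $A_2\ge 0$ and $0\in\sigma_p((-A_1)^{1/2})\cap\sigma_p(A_2^{1/2})$. Let $L_0=L_{10}\oplus L_{20}$ be the minimal operator generated in $L_2=L_2(H,(-\infty,a))\oplus L_2(H,(b,\infty))$ by the differential expression $l(u)=(u_1'+A_1u_1,\;u_2'+A_2u_2)$, $u=(u_1,u_2)$. Then the point spectrum of any normal extension $L_W$ of $L_0$ in $L_2$ is empty, i.e. $\sigma_p(L_W)=\emptyset$.
   Context: Minimal operators. $L_{10}$ (resp. $L_{20}$) is the minimal operator generated by $l_1(u_1)=u_1'+A_1u_1$ in $L_2(H,(-\infty,a))$ (resp. by $l_2(u_2)=u_2'+A_2u_2$ in $L_2(H,(b,\infty))$), that is, the closure of the differential expression restricted to finite sums $\sum_j\varphi_j(t)f_j$ with $\varphi_j\in C_0^\infty$ of the open interval and $f_j\in D(A_k)$. Normal operators. A densely defined closed operator $N$ in a Hilbert space is formally normal if $D(N)\subset D(N^* )$ and $\|Nf\|=\|N^*f\|$ for all $f\in D(N)$. A formally normal operator $N$ is normal if $D(N)=D(N^* )$. A normal extension of $L_0$ is a normal operator in $L_2$ that extends $L_0$; it is denoted $L_W$ (the subscript refers to a unitary operator $W$ in $H$ with $u_2(b)=Wu_1(a)$ on the domain of the extension). $\sigma_p$ denotes the point spectrum (set of eigenvalues). *)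

theory Defs
  imports "HOL-Analysis.Analysis"
begin

section \<open>Complex inner product spaces\<close>

text \<open>The library only has real inner product spaces. A complex one is rendered as a
  \<^class>\<open>real_inner\<close> space carrying a complex scalar multiplication and a complex inner product
  (linear in the first argument) whose real part is the given real inner product; so norm and
  topology are those of the library.\<close>

class complex_inner = real_inner +
  fixes scaleC :: "complex \<Rightarrow> 'a \<Rightarrow> 'a"  (infixr "*\<^sub>C" 75)
    and cinner :: "'a \<Rightarrow> 'a \<Rightarrow> complex"
  assumes scaleC_add_right: "c *\<^sub>C (x + y) = c *\<^sub>C x + c *\<^sub>C y"
    and scaleC_add_left: "(c + d) *\<^sub>C x = c *\<^sub>C x + d *\<^sub>C x"
    and scaleC_scaleC: "c *\<^sub>C d *\<^sub>C x = (c * d) *\<^sub>C x"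
    and scaleC_of_real: "complex_of_real r *\<^sub>C x = r *\<^sub>R x"
    and cinner_commute: "cinner x y = cnj (cinner y x)"
    and cinner_add_left: "cinner (x + y) z = cinner x z + cinner y z"
    and cinner_scaleC_left: "cinner (c *\<^sub>C x) y = c * cinner x y"
    and inner_eq_Re_cinner: "inner x y = Re (cinner x y)"

class chilbert_space = complex_inner + complete_space

lemma norm_scaleC: "norm (c *\<^sub>C x) = cmod c * norm x" for x :: "'a::complex_inner"
proof -
  have "cinner x (c *\<^sub>C x) = cnj c * cinner x x"
    using cinner_commute[of x "c *\<^sub>C x"] cinner_commute[of x x, symmetric] by (simp add: cinner_scaleC_left)
  then have "cinner (c *\<^sub>C x) (c *\<^sub>C x) = c * cnj c * cinner x x"
    by (simp add: cinner_scaleC_left)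
  also have "\<dots> = complex_of_real ((cmod c)\<^sup>2) * cinner x x"
    by (simp only: complex_norm_square)
  finally have "inner (c *\<^sub>C x) (c *\<^sub>C x) = (cmod c)\<^sup>2 * inner x x"
    by (simp add: inner_eq_Re_cinner)
  then show ?thesis
    by (simp add: norm_eq_sqrt_inner[of "c *\<^sub>C x"] norm_eq_sqrt_inner[of x] real_sqrt_mult)
qed

lemma bounded_linear_scaleC: "bounded_linear (\<lambda>x::'a::complex_inner. c *\<^sub>C x)"
proof (rule bounded_linear_intro)
  fix r :: real and x y :: 'a
  show "c *\<^sub>C (x + y) = c *\<^sub>C x + c *\<^sub>C y" by (rule scaleC_add_right)
  show "c *\<^sub>C (r *\<^sub>R x) = r *\<^sub>R c *\<^sub>C x"
    by (simp add: scaleC_scaleC mult.commute flip: scaleC_of_real)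
  show "norm (c *\<^sub>C x) \<le> norm x * cmod c" by (simp add: norm_scaleC)
qed

lemma cinner_eq_inner:
  "cinner x y = Complex (inner x y) (inner ((- \<i>) *\<^sub>C x) y)" for x y :: "'a::complex_inner"
  by (simp add: inner_eq_Re_cinner cinner_scaleC_left complex_eq_iff)

instantiation prod :: (complex_inner, complex_inner) complex_inner
begin

definition scaleC_prod_def: "c *\<^sub>C p = (c *\<^sub>C fst p, c *\<^sub>C snd p)"
definition cinner_prod_def: "cinner p q = cinner (fst p) (fst q) + cinner (snd p) (snd q)"

instance
proof
  fix x y z :: "'a \<times> 'b" and c d :: complex and r :: real
  show "c *\<^sub>C (x + y) = c *\<^sub>C x + c *\<^sub>C y"
    by (simp add: scaleC_prod_def scaleC_add_right)
  show "(c + d) *\<^sub>C x = c *\<^sub>C x + d *\<^sub>C x"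
    by (simp add: scaleC_prod_def scaleC_add_left)
  show "c *\<^sub>C d *\<^sub>C x = (c * d) *\<^sub>C x"
    by (simp add: scaleC_prod_def scaleC_scaleC)
  show "complex_of_real r *\<^sub>C x = r *\<^sub>R x"
    by (simp add: scaleC_prod_def scaleC_of_real scaleR_prod_def)
  show "cinner x y = cnj (cinner y x)"
    using cinner_commute[of "fst x" "fst y"] cinner_commute[of "snd x" "snd y"]
    by (simp add: cinner_prod_def)
  show "cinner (x + y) z = cinner x z + cinner y z"
    by (simp add: cinner_prod_def cinner_add_left)
  show "cinner (c *\<^sub>C x) y = c * cinner x y"
    by (simp add: cinner_prod_def scaleC_prod_def cinner_scaleC_left algebra_simps)
  show "inner x y = Re (cinner x y)"
    by (simp add: cinner_prod_def inner_prod_def inner_eq_Re_cinner)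
qed

end


section \<open>Square integrable vector functions\<close>

definition square_integrable :: "(real \<Rightarrow> 'h::{complex_inner, second_countable_topology}) \<Rightarrow> bool" where
  "square_integrable f \<longleftrightarrow> f \<in> borel_measurable lborel \<and> integrable lborel (\<lambda>t. (norm (f t))\<^sup>2)"

lemma square_integrable_0: "square_integrable (\<lambda>_. 0)"
  by (simp add: square_integrable_def)

lemma square_integrable_add:
  assumes "square_integrable f" "square_integrable g"
  shows "square_integrable (\<lambda>t. f t + g t)"
  unfolding square_integrable_def
proof
  have [measurable]: "f \<in> borel_measurable lborel" "g \<in> borel_measurable lborel"
    using assms by (auto simp: square_integrable_def)
  show "(\<lambda>t. f t + g t) \<in> borel_measurable lborel" by measurable
  show "integrable lborel (\<lambda>t. (norm (f t + g t))\<^sup>2)"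
  proof (rule Bochner_Integration.integrable_bound)
    show "integrable lborel (\<lambda>t. 2 * (norm (f t))\<^sup>2 + 2 * (norm (g t))\<^sup>2)"
      using assms by (auto simp: square_integrable_def)
    have "(norm (x + y))\<^sup>2 \<le> 2 * (norm x)\<^sup>2 + 2 * (norm y)\<^sup>2" for x y :: 'a
    proof -
      have "(norm (x + y))\<^sup>2 \<le> (norm x + norm y)\<^sup>2"
        by (intro power_mono norm_triangle_ineq) auto
      also have "\<dots> \<le> 2 * (norm x)\<^sup>2 + 2 * (norm y)\<^sup>2"
        using sum_squares_bound[of "norm x" "norm y"] by (simp add: power2_sum)
      finally show ?thesis .
    qed
    then show "AE t in lborel. norm ((norm (f t + g t))\<^sup>2)
        \<le> norm (2 * (norm (f t))\<^sup>2 + 2 * (norm (g t))\<^sup>2)"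
      by auto
  qed auto
qed

lemma measurable_scaleC [measurable (raw)]:
  fixes f :: "'b \<Rightarrow> 'h::{complex_inner, second_countable_topology}"
  assumes "f \<in> borel_measurable M"
  shows "(\<lambda>t. c *\<^sub>C f t) \<in> borel_measurable M"
  using borel_measurable_continuous_on[OF _ assms, of "\<lambda>x. c *\<^sub>C x"]
    bounded_linear.continuous_on[OF bounded_linear_scaleC continuous_on_id] by auto

lemma measurable_cinner [measurable (raw)]:
  fixes f :: "'b \<Rightarrow> 'h::{complex_inner, second_countable_topology}"
  assumes [measurable]: "f \<in> borel_measurable M" "g \<in> borel_measurable M"
  shows "(\<lambda>t. cinner (f t) (g t)) \<in> borel_measurable M"
  unfolding cinner_eq_inner Complex_eq by measurable

lemma square_integrable_scaleC:
  assumes "square_integrable f"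
  shows "square_integrable (\<lambda>t. c *\<^sub>C f t)"
  using assms by (auto simp: square_integrable_def norm_scaleC power_mult_distrib)

lemma square_integrable_scaleR:
  assumes "square_integrable f"
  shows "square_integrable (\<lambda>t. r *\<^sub>R f t)"
  using square_integrable_scaleC[OF assms, of "of_real r"] by (simp add: scaleC_of_real)

lemma square_integrable_minus:
  assumes "square_integrable f"
  shows "square_integrable (\<lambda>t. - f t)"
  using square_integrable_scaleR[OF assms, of "-1"] by simp

lemma norm_cinner_le: "cmod (cinner x y) \<le> (norm x)\<^sup>2 + (norm y)\<^sup>2" for x y :: "'a::complex_inner"
proof -
  have "cmod (cinner x y) \<le> \<bar>inner x y\<bar> + \<bar>inner ((- \<i>) *\<^sub>C x) y\<bar>"
    unfolding cinner_eq_inner by (rule order_trans[OF cmod_le]) simp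
  also have "\<dots> \<le> norm x * norm y + norm x * norm y"
    using Cauchy_Schwarz_ineq2[of x y] Cauchy_Schwarz_ineq2[of "(- \<i>) *\<^sub>C x" y]
    by (simp add: norm_scaleC)
  also have "\<dots> \<le> (norm x)\<^sup>2 + (norm y)\<^sup>2"
    using sum_squares_bound[of "norm x" "norm y"] by simp
  finally show ?thesis .
qed

lemma integrable_cinner:
  assumes "square_integrable f" "square_integrable g"
  shows "integrable lborel (\<lambda>t. cinner (f t) (g t))"
proof (rule Bochner_Integration.integrable_bound)
  have [measurable]: "f \<in> borel_measurable lborel" "g \<in> borel_measurable lborel"
    using assms by (auto simp: square_integrable_def)
  show "integrable lborel (\<lambda>t. (norm (f t))\<^sup>2 + (norm (g t))\<^sup>2)"
    using assms by (auto simp: square_integrable_def)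
  show "(\<lambda>t. cinner (f t) (g t)) \<in> borel_measurable lborel" by measurable
  show "AE t in lborel. norm (cinner (f t) (g t)) \<le> norm ((norm (f t))\<^sup>2 + (norm (g t))\<^sup>2)"
    by (simp add: norm_cinner_le)
qed

lemma lborel_integral_cinner_cong:
  assumes "square_integrable f" "square_integrable g" "square_integrable f'" "square_integrable g'"
    and "AE t in lborel. f t = f' t" "AE t in lborel. g t = g' t"
  shows "(LINT t|lborel. cinner (f t) (g t)) = (LINT t|lborel. cinner (f' t) (g' t))"
proof (rule integral_cong_AE)
  show "(\<lambda>t. cinner (f t) (g t)) \<in> borel_measurable lborel"
    "(\<lambda>t. cinner (f' t) (g' t)) \<in> borel_measurable lborel"
    by (intro borel_measurable_integrable[OF integrable_cinner] assms(1-4))+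
  show "AE t in lborel. cinner (f t) (g t) = cinner (f' t) (g' t)"
    using assms(5,6) by eventually_elim simp
qed

text \<open>The Hilbert space \<open>L\<^sub>2(H, \<real>)\<close>, as classes of functions modulo equality almost everywhere.\<close>

quotient_type (overloaded) 'h l2 = "real \<Rightarrow> 'h::{complex_inner, second_countable_topology}"
  / partial: "\<lambda>f g. square_integrable f \<and> square_integrable g \<and> (AE t in lborel. f t = g t)"
proof (rule part_equivpI)
  let ?R = "\<lambda>f g::real \<Rightarrow> 'h.
    square_integrable f \<and> square_integrable g \<and> (AE t in lborel. f t = g t)"
  have "?R (\<lambda>_. 0) (\<lambda>_. 0)"
    by (simp add: square_integrable_0)
  then show "\<exists>f. ?R f f" by (rule exI[where x = "\<lambda>_. 0"])
  show "symp ?R"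
    by (rule sympI) (simp add: eq_commute)
  show "transp ?R"
  proof (rule transpI)
    fix f g h :: "real \<Rightarrow> 'h"
    assume fg: "?R f g" and gh: "?R g h"
    from fg gh have "AE t in lborel. f t = g t" "AE t in lborel. g t = h t" by blast+
    then have "AE t in lborel. f t = h t" by eventually_elim simp
    with fg gh show "?R f h" by blast
  qed
qed

instantiation l2 :: ("{complex_inner, second_countable_topology}") complex_inner
begin

lift_definition zero_l2 :: "'a l2" is "\<lambda>_. 0"
  by (simp add: square_integrable_0)

lift_definition plus_l2 :: "'a l2 \<Rightarrow> 'a l2 \<Rightarrow> 'a l2" is "\<lambda>f g t. f t + g t"
  by (auto intro: square_integrable_add)

lift_definition uminus_l2 :: "'a l2 \<Rightarrow> 'a l2" is "\<lambda>f t. - f t"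
  by (auto intro: square_integrable_minus)

lift_definition scaleR_l2 :: "real \<Rightarrow> 'a l2 \<Rightarrow> 'a l2" is "\<lambda>r f t. r *\<^sub>R f t"
  by (auto intro: square_integrable_scaleR)

lift_definition scaleC_l2 :: "complex \<Rightarrow> 'a l2 \<Rightarrow> 'a l2" is "\<lambda>c f t. c *\<^sub>C f t"
  by (auto intro: square_integrable_scaleC)

lift_definition cinner_l2 :: "'a l2 \<Rightarrow> 'a l2 \<Rightarrow> complex"
  is "\<lambda>f g. LINT t|lborel. cinner (f t) (g t)"
  by (rule lborel_integral_cinner_cong) auto

definition minus_l2 :: "'a l2 \<Rightarrow> 'a l2 \<Rightarrow> 'a l2" where "minus_l2 u v = u + - v"
definition inner_l2 :: "'a l2 \<Rightarrow> 'a l2 \<Rightarrow> real" where "inner_l2 u v = Re (cinner u v)"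
definition norm_l2 :: "'a l2 \<Rightarrow> real" where "norm_l2 u = sqrt (inner u u)"
definition sgn_l2 :: "'a l2 \<Rightarrow> 'a l2" where "sgn_l2 u = inverse (norm u) *\<^sub>R u"
definition dist_l2 :: "'a l2 \<Rightarrow> 'a l2 \<Rightarrow> real" where "dist_l2 u v = norm (u - v)"
definition uniformity_l2 :: "('a l2 \<times> 'a l2) filter" where
  "uniformity_l2 = (INF e\<in>{0<..}. principal {(u, v). dist u v < e})"
definition open_l2 :: "'a l2 set \<Rightarrow> bool" where
  "open_l2 U \<longleftrightarrow> (\<forall>x\<in>U. eventually (\<lambda>(x', y). x' = x \<longrightarrow> y \<in> U) uniformity)"

instance
proof
  fix u v w :: "'a l2" and r s :: real and c d :: complex
  show "u + v + w = u + (v + w)"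
    by transfer (auto simp: add.assoc intro!: square_integrable_add)
  show "u + v = v + u"
    by transfer (auto simp: add.commute intro!: square_integrable_add)
  show "0 + u = u"
    by transfer auto
  show "- u + u = 0"
    by transfer (auto simp: square_integrable_0)
  show "u - v = u + - v" by (rule minus_l2_def)
  show "r *\<^sub>R (u + v) = r *\<^sub>R u + r *\<^sub>R v"
    by transfer (auto simp: scaleR_add_right intro!: square_integrable_add square_integrable_scaleR)
  show "(r + s) *\<^sub>R u = r *\<^sub>R u + s *\<^sub>R u"
    by transfer (auto simp: scaleR_add_left intro!: square_integrable_add square_integrable_scaleR)
  show "r *\<^sub>R s *\<^sub>R u = (r * s) *\<^sub>R u"
    by transfer (auto intro!: square_integrable_scaleR)
  show "1 *\<^sub>R u = u" by transfer auto
  show "c *\<^sub>C (u + v) = c *\<^sub>C u + c *\<^sub>C v"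
    by transfer (auto simp: scaleC_add_right intro!: square_integrable_add square_integrable_scaleC)
  show "(c + d) *\<^sub>C u = c *\<^sub>C u + d *\<^sub>C u"
    by transfer (auto simp: scaleC_add_left intro!: square_integrable_add square_integrable_scaleC)
  show "c *\<^sub>C d *\<^sub>C u = (c * d) *\<^sub>C u"
    by transfer (auto simp: scaleC_scaleC intro!: square_integrable_scaleC)
  show of_real: "complex_of_real r *\<^sub>C u = r *\<^sub>R u" for r and u :: "'a l2"
    by transfer (auto simp: scaleC_of_real intro!: square_integrable_scaleR)
  show com: "cinner u v = cnj (cinner v u)" for u v :: "'a l2"
  proof transfer
    fix f g :: "real \<Rightarrow> 'a"
    have "(LINT t|lborel. cinner (f t) (g t)) = (LINT t|lborel. cnj (cinner (g t) (f t)))"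
      by (intro Bochner_Integration.integral_cong refl cinner_commute)
    then show "(LINT t|lborel. cinner (f t) (g t)) = cnj (LINT t|lborel. cinner (g t) (f t))"
      by simp
  qed
  show add: "cinner (u + v) w = cinner u w + cinner v w" for u v w :: "'a l2"
    by transfer (auto simp: cinner_add_left integrable_cinner)
  show scale: "cinner (c *\<^sub>C u) v = c * cinner u v" for c and u v :: "'a l2"
    by transfer (auto simp: cinner_scaleC_left integrable_cinner)
  show "inner u v = Re (cinner u v)" by (rule inner_l2_def)
  show "inner u v = inner v u"
    using arg_cong[OF com[of u v], of Re] by (simp add: inner_l2_def)
  show "inner (u + v) w = inner u w + inner v w"
    by (simp add: inner_l2_def add)
  show "inner (r *\<^sub>R u) v = r * inner u v"
    unfolding inner_l2_def of_real[symmetric] scale by simp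
  have int: "(LINT t|lborel. cinner (f t) (f t)) = complex_of_real (LINT t|lborel. (norm (f t))\<^sup>2)"
    for f :: "real \<Rightarrow> 'a"
  proof -
    have "cinner x x = complex_of_real ((norm x)\<^sup>2)" for x :: 'a
      using cinner_commute[of x x, symmetric] inner_eq_Re_cinner[of x x]
      by (auto simp: complex_eq_iff power2_norm_eq_inner)
    then show ?thesis by (simp only: integral_complex_of_real)
  qed
  show "0 \<le> inner u u"
    unfolding inner_l2_def by transfer (simp add: int)
  show "inner u u = 0 \<longleftrightarrow> u = 0"
    unfolding inner_l2_def
    by transfer (auto simp: int square_integrable_0 square_integrable_def
        integral_nonneg_eq_0_iff_AE)
  show "norm u = sqrt (inner u u)" by (rule norm_l2_def)
  show "sgn u = inverse (norm u) *\<^sub>R u" by (rule sgn_l2_def)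
  show "dist u v = norm (u - v)" by (rule dist_l2_def)
  show "uniformity = (INF e\<in>{0<..}. principal {(u::'a l2, v). dist u v < e})"
    by (rule uniformity_l2_def)
  show "open U \<longleftrightarrow> (\<forall>x\<in>U. eventually (\<lambda>(x', y). x' = x \<longrightarrow> y \<in> U) uniformity)"
    for U :: "'a l2 set" by (rule open_l2_def)
qed

end

text \<open>\<open>L\<^sub>2(H, I)\<close>, as the closed subspace of \<open>L\<^sub>2(H, \<real>)\<close> of the classes vanishing almost everywhere
  outside \<open>I\<close> (extension by zero).\<close>

lift_definition l2_on :: "real set \<Rightarrow> 'h::{complex_inner, second_countable_topology} l2 \<Rightarrow> bool"
  is "\<lambda>I f. AE t in lborel. t \<notin> I \<longrightarrow> f t = 0"
proof -
  have *: "AE t in lborel. t \<notin> I \<longrightarrow> g t = 0"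
    if "AE t in lborel. f t = g t" "AE t in lborel. t \<notin> I \<longrightarrow> f t = 0"
    for I and f g :: "real \<Rightarrow> 'h"
    using that by eventually_elim auto
  show "(AE t in lborel. t \<notin> I \<longrightarrow> f t = 0) \<longleftrightarrow> (AE t in lborel. t \<notin> I \<longrightarrow> g t = 0)"
    if "square_integrable f \<and> square_integrable g \<and> (AE t in lborel. f t = g t)"
    for I and f g :: "real \<Rightarrow> 'h"
  proof -
    from that have fg: "AE t in lborel. f t = g t" by blast
    then have gf: "AE t in lborel. g t = f t" by eventually_elim simp
    show ?thesis using *[OF fg] *[OF gf] by blast
  qed
qed

definition L2 :: "real set \<Rightarrow> 'h::{complex_inner, second_countable_topology} l2 set" where
  "L2 I = {u. l2_on I u}"


section \<open>Unbounded operators\<close>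

text \<open>An operator is identified with its graph. The set \<open>X\<close> is the closed subspace of the ambient
  inner product space that plays the role of the Hilbert space in which the operator acts; density
  and adjoints are taken relative to \<open>X\<close>.\<close>

definition linear_operator_in :: "'a::complex_inner set \<Rightarrow> ('a \<times> 'a) set \<Rightarrow> bool" where
  "linear_operator_in X T \<longleftrightarrow> T \<subseteq> X \<times> X \<and> single_valued T \<and> 0 \<in> T \<and>
     (\<forall>p\<in>T. \<forall>q\<in>T. p + q \<in> T) \<and> (\<forall>c. \<forall>p\<in>T. c *\<^sub>C p \<in> T)"

definition densely_defined_in :: "'a::complex_inner set \<Rightarrow> ('a \<times> 'a) set \<Rightarrow> bool" where
  "densely_defined_in X T \<longleftrightarrow> X \<subseteq> closure (Domain T)"

definition adjoint_in :: "'a::complex_inner set \<Rightarrow> ('a \<times> 'a) set \<Rightarrow> ('a \<times> 'a) set" where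
  "adjoint_in X T = {(v, w). v \<in> X \<and> w \<in> X \<and> (\<forall>(u, u')\<in>T. cinner u' v = cinner u w)}"

definition selfadjoint_in :: "'a::complex_inner set \<Rightarrow> ('a \<times> 'a) set \<Rightarrow> bool" where
  "selfadjoint_in X T \<longleftrightarrow> linear_operator_in X T \<and> densely_defined_in X T \<and> adjoint_in X T = T"

definition op_uminus :: "('a::complex_inner \<times> 'a) set \<Rightarrow> ('a \<times> 'a) set" where
  "op_uminus T = {(u, - v) | u v. (u, v) \<in> T}"

definition op_nonneg :: "('a::complex_inner \<times> 'a) set \<Rightarrow> bool" where
  "op_nonneg T \<longleftrightarrow> (\<forall>(u, v)\<in>T. cinner v u \<in> \<real>\<^sub>\<ge>\<^sub>0)"

definition op_nonpos :: "('a::complex_inner \<times> 'a) set \<Rightarrow> bool" where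
  "op_nonpos T \<longleftrightarrow> (\<forall>(u, v)\<in>T. cinner v u \<in> \<real>\<^sub>\<le>\<^sub>0)"

text \<open>The unique nonnegative selfadjoint \<open>B\<close> with \<open>B\<^sup>2 = T\<close>. For \<open>T\<close> nonnegative and selfadjoint in a
  Hilbert space it exists and is unique by the spectral theorem.\<close>

definition op_sqrt :: "('a::complex_inner \<times> 'a) set \<Rightarrow> ('a \<times> 'a) set" where
  "op_sqrt T = (THE B. selfadjoint_in UNIV B \<and> op_nonneg B \<and> B O B = T)"

definition formally_normal_in :: "'a::complex_inner set \<Rightarrow> ('a \<times> 'a) set \<Rightarrow> bool" where
  "formally_normal_in X N \<longleftrightarrow>
     linear_operator_in X N \<and> closed N \<and> densely_defined_in X N \<and>
     Domain N \<subseteq> Domain (adjoint_in X N) \<and>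
     (\<forall>f g h. (f, g) \<in> N \<longrightarrow> (f, h) \<in> adjoint_in X N \<longrightarrow> norm g = norm h)"

definition normal_in :: "'a::complex_inner set \<Rightarrow> ('a \<times> 'a) set \<Rightarrow> bool" where
  "normal_in X N \<longleftrightarrow> formally_normal_in X N \<and> Domain N = Domain (adjoint_in X N)"

definition normal_extension_in :: "'a::complex_inner set \<Rightarrow> ('a \<times> 'a) set \<Rightarrow> ('a \<times> 'a) set \<Rightarrow> bool" where
  "normal_extension_in X T N \<longleftrightarrow> normal_in X N \<and> T \<subseteq> N"

definition point_spectrum :: "('a::complex_inner \<times> 'a) set \<Rightarrow> complex set" where
  "point_spectrum T = {\<mu>. \<exists>u. u \<noteq> 0 \<and> (u, \<mu> *\<^sub>C u) \<in> T}"

definition op_direct_sum ::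
    "('a::complex_inner \<times> 'a) set \<Rightarrow> ('b::complex_inner \<times> 'b) set \<Rightarrow> (('a \<times> 'b) \<times> ('a \<times> 'b)) set" where
  "op_direct_sum S T = {((u\<^sub>1, u\<^sub>2), (v\<^sub>1, v\<^sub>2)) | u\<^sub>1 u\<^sub>2 v\<^sub>1 v\<^sub>2. (u\<^sub>1, v\<^sub>1) \<in> S \<and> (u\<^sub>2, v\<^sub>2) \<in> T}"


section \<open>Minimal operators\<close>

definition test_function :: "real set \<Rightarrow> (real \<Rightarrow> complex) \<Rightarrow> bool" where
  "test_function I \<phi> \<longleftrightarrow>
     (\<forall>n t. ((\<lambda>\<psi> s. vector_derivative \<psi> (at s)) ^^ n) \<phi> differentiable (at t)) \<and>
     compact (closure {t. \<phi> t \<noteq> 0}) \<and> closure {t. \<phi> t \<noteq> 0} \<subseteq> I"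

text \<open>The expression \<open>u' + A u\<close> on the finite sums \<open>\<Sum>\<^sub>j \<phi>\<^sub>j(t) f\<^sub>j\<close>. These sums and their images are
  continuous with compact support, so \<^term>\<open>abs_l2\<close> is applied to square integrable functions only.\<close>

definition preminimal_operator ::
    "('h::{complex_inner, second_countable_topology} \<times> 'h) set \<Rightarrow> real set \<Rightarrow> ('h l2 \<times> 'h l2) set" where
  "preminimal_operator A I =
     {(abs_l2 (\<lambda>t. \<Sum>j<n. \<phi> j t *\<^sub>C f j),
       abs_l2 (\<lambda>t. \<Sum>j<n. vector_derivative (\<phi> j) (at t) *\<^sub>C f j + \<phi> j t *\<^sub>C g j))
      | (n::nat) \<phi> f g. \<forall>j<n. test_function I (\<phi> j) \<and> (f j, g j) \<in> A}"

definition minimal_operator ::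
    "('h::{complex_inner, second_countable_topology} \<times> 'h) set \<Rightarrow> real set \<Rightarrow> ('h l2 \<times> 'h l2) set" where
  "minimal_operator A I = closure (preminimal_operator A I)"

end

theory Submission
  imports Defs
begin

text \<open>Let \<open>N\<close> be a normal extension and \<open>N u = \<mu> u\<close>. Then \<open>N\<^sup>* u = cnj \<mu> u\<close>. On a vector valued test
  function \<open>x = \<phi> f\<close> with \<open>f\<close> in the domain of \<open>A\<close>, the extension acts as \<open>N x = \<phi>' f + \<phi> A f\<close>. Normality
  puts \<open>x\<close> in the domain of \<open>N\<^sup>*\<close> as well, and there \<open>N\<^sup>*\<close> acts as the formal adjoint,
  \<open>N\<^sup>* x = - \<phi>' f + \<phi> A f\<close>, because the test functions are total. Pairing both with \<open>u\<close> and
  subtracting eliminates \<open>A\<close> (\<open>normal_eigenvector_identity\<close>) and leaves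
  \<open>\<langle>\<phi>' f, u\<rangle> = i (Im \<mu>) \<langle>\<phi> f, u\<rangle>\<close>.

  This says weakly that \<open>u' = i c u\<close> with a real constant \<open>c\<close>, on each of the two half lines. So \<open>\<parallel>u(t)\<parallel>\<close> is
  constant there, and as \<open>u\<close> is square integrable on a set of infinite length, \<open>u = 0\<close>
  (\<open>no_square_integrable_oscillation\<close>).

  The vanishing itself is read off from the integrals
  \<open>\<integral> \<eta> \<langle>f, V\<rangle>\<close>, where \<open>V\<close> is \<open>u\<close> freed from the oscillation: they are unchanged by translation of
  the bump \<open>\<eta>\<close> and tend to zero as it escapes to infinity
  (\<open>vanishes_if_orthogonal_to_bump_derivatives\<close>). Two facts about smooth functions of compact
  support remain: there are enough of them to detect every square integrable function
  (\<open>vanishes_if_orthogonal_to_bumps\<close>), and they are test functions of the minimal operators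
  (\<open>bump_test_function\<close>).\<close>

section \<open>Smooth functions with compact support\<close>

text \<open>Smoothness is built from finitely many derivatives at a time because the induction on that
  number proves stability under products, where the derivative is a sum of two products rather than
  a product.\<close>

primrec times_differentiable :: "nat \<Rightarrow> (real \<Rightarrow> 'a::real_normed_vector) \<Rightarrow> bool" where
  "times_differentiable 0 f \<longleftrightarrow> True"
| "times_differentiable (Suc k) f \<longleftrightarrow>
     (\<exists>f'. (\<forall>t. (f has_vector_derivative f' t) (at t)) \<and> times_differentiable k f')"

definition smooth :: "(real \<Rightarrow> 'a::real_normed_vector) \<Rightarrow> bool" where
  "smooth f \<longleftrightarrow> (\<forall>k. times_differentiable k f)"

lemma times_differentiable_SucI:
  "(\<And>t. (f has_vector_derivative f' t) (at t)) \<Longrightarrow> times_differentiable k f' \<Longrightarrow>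
    times_differentiable (Suc k) f"
  by auto

lemma times_differentiable_SucD: "times_differentiable (Suc k) f \<Longrightarrow> times_differentiable k f"
proof (induction k arbitrary: f)
  case (Suc k)
  then show ?case by (metis times_differentiable.simps(2))
qed simp

lemma times_differentiable_add:
  "times_differentiable k f \<Longrightarrow> times_differentiable k g \<Longrightarrow> times_differentiable k (\<lambda>t. f t + g t)"
proof (induction k arbitrary: f g)
  case (Suc k)
  obtain f' where f: "\<And>t. (f has_vector_derivative f' t) (at t)" "times_differentiable k f'"
    using Suc.prems(1) by auto
  obtain g' where g: "\<And>t. (g has_vector_derivative g' t) (at t)" "times_differentiable k g'"
    using Suc.prems(2) by auto
  have "((\<lambda>t. f t + g t) has_vector_derivative f' t + g' t) (at t)" for t
    by (intro has_vector_derivative_add f g)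
  from times_differentiable_SucI[OF this Suc.IH[OF f(2) g(2)]] show ?case .
qed simp

lemma times_differentiable_bounded_linear:
  assumes "bounded_linear h"
  shows "times_differentiable k f \<Longrightarrow> times_differentiable k (\<lambda>t. h (f t))"
proof (induction k arbitrary: f)
  case (Suc k)
  obtain f' where f: "\<And>t. (f has_vector_derivative f' t) (at t)" "times_differentiable k f'"
    using Suc.prems by auto
  have "((\<lambda>t. h (f t)) has_vector_derivative h (f' t)) (at t)" for t
    by (intro bounded_linear.has_vector_derivative[OF assms] f)
  from times_differentiable_SucI[OF this Suc.IH[OF f(2)]] show ?case .
qed simp

lemma times_differentiable_mult:
  fixes f g :: "real \<Rightarrow> 'a::real_normed_algebra"
  shows "times_differentiable k f \<Longrightarrow> times_differentiable k g \<Longrightarrow>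
    times_differentiable k (\<lambda>t. f t * g t)"
proof (induction k arbitrary: f g)
  case (Suc k)
  obtain f' where f: "\<And>t. (f has_vector_derivative f' t) (at t)" "times_differentiable k f'"
    using Suc.prems(1) by auto
  obtain g' where g: "\<And>t. (g has_vector_derivative g' t) (at t)" "times_differentiable k g'"
    using Suc.prems(2) by auto
  have "((\<lambda>t. f t * g t) has_vector_derivative f t * g' t + f' t * g t) (at t)" for t
    by (intro has_vector_derivative_mult f g)
  moreover have "times_differentiable k (\<lambda>t. f t * g' t + f' t * g t)"
    using Suc.IH[OF times_differentiable_SucD[OF Suc.prems(1)] g(2)]
      Suc.IH[OF f(2) times_differentiable_SucD[OF Suc.prems(2)]]
    by (rule times_differentiable_add)
  ultimately show ?case by (rule times_differentiable_SucI)
qed simp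

lemma times_differentiable_affine:
  "times_differentiable k f \<Longrightarrow> times_differentiable k (\<lambda>t. f (m * t + c))"
proof (induction k arbitrary: f)
  case (Suc k)
  obtain f' where f: "\<And>t. (f has_vector_derivative f' t) (at t)" "times_differentiable k f'"
    using Suc.prems by auto
  have "((\<lambda>t. f (m * t + c)) has_vector_derivative m *\<^sub>R f' (m * t + c)) (at t)" for t
  proof -
    have "((\<lambda>t. m * t + c) has_vector_derivative m) (at t)"
      by (auto intro!: derivative_eq_intros)
    from vector_diff_chain_at[OF this f(1)] show ?thesis by (simp add: o_def)
  qed
  moreover have "times_differentiable k (\<lambda>t. m *\<^sub>R f' (m * t + c))"
    by (rule times_differentiable_bounded_linear[OF bounded_linear_scaleR_right Suc.IH[OF f(2)]])
  ultimately show ?case by (rule times_differentiable_SucI)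
qed simp

lemma smooth_continuous: "smooth f \<Longrightarrow> continuous_on S f"
proof -
  assume "smooth f"
  then have "times_differentiable (Suc 0) f" unfolding smooth_def by blast
  then obtain f' where "\<And>t. (f has_vector_derivative f' t) (at t)" by auto
  then show ?thesis
    by (auto intro!: continuous_at_imp_continuous_on has_vector_derivative_continuous)
qed

lemma smooth_derivative:
  assumes "smooth f" "\<And>t. (f has_vector_derivative f' t) (at t)"
  shows "smooth f'"
  unfolding smooth_def
proof
  fix k
  obtain g where "\<And>t. (f has_vector_derivative g t) (at t)" "times_differentiable k g"
    using assms(1) unfolding smooth_def by (metis times_differentiable.simps(2))
  moreover have "g = f'"
    using vector_derivative_unique_at calculation(1) assms(2) by blast
  ultimately show "times_differentiable k f'" by simp
qed

lemma smooth_antiderivative: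
  assumes "smooth f'" "\<And>t. (f has_vector_derivative f' t) (at t)"
  shows "smooth f"
  unfolding smooth_def
proof
  fix k show "times_differentiable k f"
    using assms unfolding smooth_def by (cases k) auto
qed

lemma smooth_iterated_derivative:
  assumes "smooth f"
  shows "smooth (((\<lambda>g s. vector_derivative g (at s)) ^^ n) f)"
proof (induction n)
  case (Suc n)
  let ?g = "((\<lambda>g s. vector_derivative g (at s)) ^^ n) f"
  have "times_differentiable (Suc 0) ?g" using Suc unfolding smooth_def by blast
  then obtain g' where g': "\<And>t. (?g has_vector_derivative g' t) (at t)" by auto
  then have "(\<lambda>s. vector_derivative ?g (at s)) = g'" by (auto intro!: vector_derivative_at)
  with smooth_derivative[OF Suc g'] show ?case by simp
qed (use assms in simp)

lemma smooth_mult: "smooth f \<Longrightarrow> smooth g \<Longrightarrow> smooth (\<lambda>t. f t * g t)"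
  for f g :: "real \<Rightarrow> 'a::real_normed_algebra"
  unfolding smooth_def by (blast intro: times_differentiable_mult)

lemma smooth_affine: "smooth f \<Longrightarrow> smooth (\<lambda>t. f (m * t + c))"
  unfolding smooth_def by (blast intro: times_differentiable_affine)

lemma smooth_bounded_linear: "bounded_linear h \<Longrightarrow> smooth f \<Longrightarrow> smooth (\<lambda>t. h (f t))"
  unfolding smooth_def by (blast intro: times_differentiable_bounded_linear)

lemma smooth_diff: "smooth f \<Longrightarrow> smooth g \<Longrightarrow> smooth (\<lambda>t. f t - g t)"
  using times_differentiable_add[of _ f "\<lambda>t. - g t"]
    times_differentiable_bounded_linear[OF bounded_linear_minus[OF bounded_linear_ident], of _ g]
  unfolding smooth_def by simp

text \<open>The flat function \<open>exp (- 1 / t)\<close>, extended by zero to \<open>t \<le> 0\<close>, is the source of all bumps.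
  Carrying the powers of \<open>1 / t\<close> along makes the family closed under differentiation up to linear
  combinations, so that smoothness is an induction on the number of derivatives.\<close>

definition flat :: "nat \<Rightarrow> real \<Rightarrow> real" where
  "flat m t = (if t > 0 then (1 / t) ^ m * exp (- (1 / t)) else 0)"

lemma flat_tendsto_0: "(flat m \<longlongrightarrow> 0) (at 0)"
proof (rule filterlim_split_at)
  have "eventually (\<lambda>t. flat m t = 0) (at_left 0)"
    by (auto simp: eventually_at_filter flat_def)
  then show "(flat m \<longlongrightarrow> 0) (at_left 0)" by (rule tendsto_eventually)
  have "((\<lambda>t. (inverse t) ^ m / exp (inverse t)) \<longlongrightarrow> (0::real)) (at_right 0)"
    by (rule filterlim_compose[OF tendsto_power_div_exp_0 filterlim_inverse_at_top_right])
  then show "(flat m \<longlongrightarrow> 0) (at_right 0)"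
    by (rule Lim_transform_eventually)
      (auto simp: eventually_at_filter flat_def exp_minus field_simps)
qed

lemma flat_has_derivative:
  "(flat m has_vector_derivative flat (m + 2) t - real m * flat (m + 1) t) (at t)"
proof (cases t "0::real" rule: linorder_cases)
  case less
  have "((\<lambda>_. 0) has_vector_derivative 0) (at t)" by simp
  then have "(flat m has_vector_derivative 0) (at t)"
    by (rule has_vector_derivative_transform_within_open[where S = "{..<0}"])
      (use less in \<open>auto simp: flat_def\<close>)
  then show ?thesis using less by (simp add: flat_def)
next
  case equal
  have "((\<lambda>h. (flat m (0 + h) - flat m 0) / h) \<longlongrightarrow> 0) (at 0)"
    by (rule Lim_transform_eventually[OF flat_tendsto_0[of "Suc m"]])
      (auto simp: eventually_at_filter flat_def)
  then have "(flat m has_field_derivative 0) (at 0)" by (simp add: DERIV_def)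
  then show ?thesis
    using equal by (simp add: flat_def has_real_derivative_iff_has_vector_derivative)
next
  case greater
  have "((\<lambda>t. (1 / t) ^ m * exp (- (1 / t))) has_field_derivative
      flat (m + 2) t - real m * flat (m + 1) t) (at t)"
  proof (rule DERIV_cong)
    show "((\<lambda>t. (1 / t) ^ m * exp (- (1 / t))) has_field_derivative
       (real m * (1 / t) ^ (m - 1) * (- 1 / t^2) * exp (- (1 / t))
        + (1 / t) ^ m * (exp (- (1 / t)) * (1 / t^2)))) (at t)"
      using greater by (auto intro!: derivative_eq_intros simp: power2_eq_square)
    show "real m * (1 / t) ^ (m - 1) * (- 1 / t^2) * exp (- (1 / t))
        + (1 / t) ^ m * (exp (- (1 / t)) * (1 / t^2)) = flat (m + 2) t - real m * flat (m + 1) t"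
      using greater by (cases m) (auto simp: flat_def power2_eq_square divide_simps algebra_simps)
  qed
  then have "((\<lambda>t. (1 / t) ^ m * exp (- (1 / t))) has_vector_derivative
      flat (m + 2) t - real m * flat (m + 1) t) (at t)"
    by (simp add: has_real_derivative_iff_has_vector_derivative)
  then show ?thesis
    by (rule has_vector_derivative_transform_within_open[where S = "{0<..}"])
      (use greater in \<open>auto simp: flat_def\<close>)
qed

lemma smooth_flat: "smooth (flat m)"
  unfolding smooth_def
proof
  fix k show "times_differentiable k (flat m)"
  proof (induction k arbitrary: m)
    case (Suc k)
    have "times_differentiable k (\<lambda>t. flat (m + 2) t + (- real m) * flat (m + 1) t)"
      by (rule times_differentiable_add[OF Suc.IH
          times_differentiable_bounded_linear[OF bounded_linear_mult_right Suc.IH]])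
    then show ?case
      by (intro times_differentiable_SucI[OF flat_has_derivative]) simp
  qed simp
qed

lemma smooth_cexp: "smooth (\<lambda>t. exp (z * complex_of_real t))"
  unfolding smooth_def
proof
  fix k show "times_differentiable k (\<lambda>t. exp (z * complex_of_real t))"
  proof (induction k)
    case (Suc k)
    have "((\<lambda>t. exp (z * complex_of_real t)) has_vector_derivative z * exp (z * complex_of_real t)) (at t)"
      for t
      by (auto intro!: derivative_eq_intros has_vector_derivative_real_field)
    moreover have "times_differentiable k (\<lambda>t. z * exp (z * complex_of_real t))"
      by (rule times_differentiable_bounded_linear[OF bounded_linear_mult_right Suc.IH])
    ultimately show ?case by (rule times_differentiable_SucI)
  qed simp
qed

text \<open>A bump is recorded together with its derivative, since every argument below pairs the two. The
  support is confined to a compact interval inside \<open>I\<close>, which makes the support conditions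
  on products, shifts and derivatives immediate.\<close>

definition bump :: "real set \<Rightarrow> (real \<Rightarrow> 'a::real_normed_vector) \<Rightarrow> (real \<Rightarrow> 'a) \<Rightarrow> bool" where
  "bump I \<phi> \<phi>' \<longleftrightarrow> smooth \<phi> \<and> (\<forall>t. (\<phi> has_vector_derivative \<phi>' t) (at t)) \<and>
     (\<exists>p q. p \<le> q \<and> {p..q} \<subseteq> I \<and> (\<forall>t. t \<notin> {p..q} \<longrightarrow> \<phi> t = 0))"

lemma bump_test_function:
  assumes "bump I \<phi> \<phi>'"
  shows "test_function I \<phi>"
proof -
  obtain p q where pq: "{p..q} \<subseteq> I" "\<And>t. t \<notin> {p..q} \<Longrightarrow> \<phi> t = 0"
    using assms unfolding bump_def by blast
  have cl: "closure {t. \<phi> t \<noteq> 0} \<subseteq> {p..q}"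
    by (intro closure_minimal subsetI) (use pq(2) in blast)+
  then have "compact (closure {t. \<phi> t \<noteq> 0})"
    by (metis bounded_subset bounded_closed_interval closed_closure compact_eq_bounded_closed)
  moreover have "((\<lambda>g s. vector_derivative g (at s)) ^^ n) \<phi> differentiable (at t)" for n t
  proof -
    have "smooth (((\<lambda>g s. vector_derivative g (at s)) ^^ n) \<phi>)"
      using assms by (intro smooth_iterated_derivative) (simp add: bump_def)
    then have "times_differentiable (Suc 0) (((\<lambda>g s. vector_derivative g (at s)) ^^ n) \<phi>)"
      unfolding smooth_def by blast
    then show ?thesis by (auto intro: differentiableI_vector)
  qed
  ultimately show ?thesis
    using cl pq(1) unfolding test_function_def by blast
qed

lemma derivative_zero_off_support:
  assumes "\<And>t. (F has_vector_derivative F' t) (at t)" "\<And>t. t \<notin> {p..q} \<Longrightarrow> F t = 0" "t \<notin> {p..q}"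
  shows "F' t = 0"
proof -
  have "((\<lambda>_. 0) has_vector_derivative 0) (at t)" by simp
  then have "(F has_vector_derivative 0) (at t)"
    by (rule has_vector_derivative_transform_within_open[where S = "- {p..q}"])
      (use assms(2,3) in auto)
  with assms(1) show ?thesis using vector_derivative_unique_at by blast
qed

lemma bump_derivative:
  assumes "bump I \<phi> \<phi>'"
  shows "\<exists>\<phi>''. bump I \<phi>' \<phi>''"
proof -
  obtain p q where pq: "p \<le> q" "{p..q} \<subseteq> I" "\<And>t. t \<notin> {p..q} \<Longrightarrow> \<phi> t = 0"
    and sm: "smooth \<phi>" and d: "\<And>t. (\<phi> has_vector_derivative \<phi>' t) (at t)"
    using assms unfolding bump_def by blast
  have sm': "smooth \<phi>'" by (rule smooth_derivative[OF sm d])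
  then have "times_differentiable (Suc 0) \<phi>'" unfolding smooth_def by blast
  then obtain \<phi>'' where d': "\<And>t. (\<phi>' has_vector_derivative \<phi>'' t) (at t)" by auto
  have "\<phi>' t = 0" if "t \<notin> {p..q}" for t
    by (rule derivative_zero_off_support[OF d pq(3) that])
  with sm' d' pq(1,2) show ?thesis unfolding bump_def by blast
qed

section \<open>Functions determined by their integrals against bumps\<close>

text \<open>On a bounded interval the sets over which the integral vanishes form a Dynkin system that contains
  the open intervals, hence all Borel sets, and a function whose integral vanishes over every Borel set is zero almost everywhere.
  Countably many such intervals with rational end points exhaust \<open>I\<close>.\<close>

lemma AE_zero_if_interval_integrals_zero:
  fixes V :: "real \<Rightarrow> 'b::{banach, second_countable_topology}"
  assumes "open I"
    and int: "\<And>p q. {p..q} \<subseteq> I \<Longrightarrow> set_integrable lborel {p<..<q} V"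
    and zero: "\<And>p q. p < q \<Longrightarrow> {p..q} \<subseteq> I \<Longrightarrow> set_lebesgue_integral lborel {p<..<q} V = 0"
  shows "AE t in lborel. t \<in> I \<longrightarrow> V t = 0"
proof -
  have local: "AE t in lborel. t \<in> {p<..<q} \<longrightarrow> V t = 0" if pq: "p < q" "{p..q} \<subseteq> I" for p q
  proof -
    define W where "W = (\<lambda>t. indicat_real {p<..<q} t *\<^sub>R V t)"
    have W: "integrable lborel W"
      using int[OF pq(2)] by (simp add: W_def set_integrable_def)
    have W_set: "set_integrable lborel A W" if "A \<in> sets borel" for A
      unfolding set_integrable_def by (rule integrable_mult_indicator) (use that W in auto)
    have W_interval: "set_lebesgue_integral lborel {x<..<y} W = 0" for x y
    proof -
      have eq: "indicat_real {x<..<y} t *\<^sub>R W t = indicat_real {max x p<..<min y q} t *\<^sub>R V t" for t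
        by (auto simp: W_def indicator_def)
      have "{max x p..min y q} \<subseteq> I" using pq(2) by (auto simp: subset_iff)
      then have "set_lebesgue_integral lborel {max x p<..<min y q} V = 0"
      proof (cases "max x p < min y q")
        case False
        then have "{max x p<..<min y q} = {}" by (simp only: greaterThanLessThan_empty not_less)
        then show ?thesis by (simp only: set_lebesgue_integral_def) simp
      qed (rule zero)
      then show ?thesis by (simp only: set_lebesgue_integral_def eq)
    qed
    have W_total: "integral\<^sup>L lborel W = 0"
      using zero[OF pq] by (simp add: W_def set_lebesgue_integral_def)
    have "set_lebesgue_integral lborel A W = 0" if "A \<in> sets lborel" for A
    proof -
      have "Int_stable (range (\<lambda>(a, b). box a b :: real set))"
        by (auto simp: Int_stable_def box_Int_box)
      moreover have "range (\<lambda>(a, b). box a b :: real set) \<subseteq> Pow UNIV" by simp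
      moreover have "A \<in> sigma_sets UNIV (range (\<lambda>(a, b). box a b :: real set))"
        using that by (simp add: borel_eq_box)
      ultimately show ?thesis
      proof (induction rule: sigma_sets_induct_disjoint)
        case (basic A)
        then show ?case using W_interval by (auto simp: box_real)
      next
        case empty
        show ?case by (simp add: set_lebesgue_integral_def)
      next
        case (compl A)
        then have A: "A \<in> sets borel" by (simp add: borel_eq_box)
        have "indicat_real (UNIV - A) t *\<^sub>R W t = W t - indicat_real A t *\<^sub>R W t" for t
          by (auto simp: indicator_def)
        then show ?case
          using compl.IH W_total W W_set[OF A]
          by (simp add: set_lebesgue_integral_def set_integrable_def)
      next
        case (union A)
        then have A: "\<And>i. A i \<in> sets borel" by (auto simp: borel_eq_box)
        have "set_lebesgue_integral lborel (\<Union>i. A i) W = (\<Sum>i. set_lebesgue_integral lborel (A i) W)"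
        proof (rule lebesgue_integral_countable_add)
          show "\<And>i. A i \<in> sets lborel" using A by simp
          show "\<And>i j. i \<noteq> j \<Longrightarrow> A i \<inter> A j = {}"
            using union.hyps by (auto simp: disjoint_family_on_def)
          show "set_integrable lborel (\<Union>i. A i) W"
            by (intro W_set sets.countable_UN) (use A in auto)
        qed
        then show ?case using union.IH by simp
      qed
    qed
    from sigma_finite_measure.density_zero[OF lborel.sigma_finite_measure_axioms W this] have "AE t in lborel. W t = 0" .
    then show ?thesis by eventually_elim (auto simp: W_def)
  qed
  define C where "C = {(p, q). p \<in> \<rat> \<and> q \<in> \<rat> \<and> p < q \<and> {p..q::real} \<subseteq> I}"
  have "countable C"
    by (rule countable_subset[of _ "\<rat> \<times> \<rat>"]) (auto simp: C_def countable_rat)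
  then have "AE t in lborel. \<forall>c\<in>C. t \<in> {fst c<..<snd c} \<longrightarrow> V t = 0"
    by (subst AE_ball_countable) (auto simp: C_def intro!: local[simplified])
  then show ?thesis
  proof eventually_elim
    case (elim t)
    show ?case
    proof
      assume "t \<in> I"
      then obtain e where e: "e > 0" "ball t e \<subseteq> I"
        using \<open>open I\<close> by (meson openE)
      obtain p where p: "p \<in> \<rat>" "t - e < p" "p < t"
        using Rats_dense_in_real[of "t - e" t] e by auto
      obtain q where q: "q \<in> \<rat>" "t < q" "q < t + e"
        using Rats_dense_in_real[of t "t + e"] e by auto
      have "{p..q} \<subseteq> ball t e" using p q by (auto simp: dist_real_def)
      then have "(p, q) \<in> C" using p q e by (auto simp: C_def)
      with elim p q show "V t = 0" by fastforce
    qed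
  qed
qed

lemma set_integrable_if_square_integrable:
  fixes V :: "real \<Rightarrow> 'b::{banach, second_countable_topology}"
  assumes [measurable]: "V \<in> borel_measurable lborel"
    and "integrable lborel (\<lambda>t. (norm (V t))\<^sup>2)"
  shows "set_integrable lborel {p<..<q} V"
  unfolding set_integrable_def
proof (rule Bochner_Integration.integrable_bound)
  show "integrable lborel (\<lambda>t. indicat_real {p<..<q} t + (norm (V t))\<^sup>2)"
    by (intro Bochner_Integration.integrable_add assms(2) integrable_real_indicator)
      (cases "p \<le> q"; simp)+
  show "(\<lambda>t. indicat_real {p<..<q} t *\<^sub>R V t) \<in> borel_measurable lborel" by measurable
  have "x \<le> 1 + x\<^sup>2" for x :: real
    using sum_squares_bound[of x 1] zero_le_power2[of x] by (simp, linarith)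
  then show "AE t in lborel. norm (indicat_real {p<..<q} t *\<^sub>R V t)
      \<le> norm (indicat_real {p<..<q} t + (norm (V t))\<^sup>2)"
    by (auto simp: indicator_def)
qed

text \<open>Bumps converge boundedly to the indicator of any interval \<open>(p, q)\<close>, so the vector \<open>\<integral>\<^sub>p\<^sup>q V\<close> is
  orthogonal to the dense set \<open>D\<close> and therefore zero.\<close>

lemma vanishes_if_orthogonal_to_bumps:
  fixes V :: "real \<Rightarrow> 'h::{real_inner, banach, second_countable_topology}"
  assumes "open I" and dense: "closure D = UNIV"
    and V: "V \<in> borel_measurable lborel" "integrable lborel (\<lambda>t. (norm (V t))\<^sup>2)"
    and orth: "\<And>\<eta> \<eta>' f. bump I \<eta> \<eta>' \<Longrightarrow> f \<in> D \<Longrightarrow> (LINT t|lborel. \<eta> t * inner f (V t)) = 0"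
  shows "AE t in lborel. t \<in> I \<longrightarrow> V t = 0"
proof (rule AE_zero_if_interval_integrals_zero[OF \<open>open I\<close>])
  show int: "set_integrable lborel {p<..<q} V" for p q
    by (rule set_integrable_if_square_integrable[OF V])
  fix p q :: real assume pq: "p < q" "{p..q} \<subseteq> I"
  let ?w = "set_lebesgue_integral lborel {p<..<q} V"
  have [measurable]: "V \<in> borel_measurable borel" using V by simp
  have "inner f ?w = 0" if "f \<in> D" for f
  proof -
    \<comment> \<open>The flat function is steepened at both end points; the exponents \<open>- 1 / ((n + 1) (t - p))\<close> and
      \<open>- 1 / ((n + 1) (q - t))\<close> tend to zero inside the interval.\<close>
    define \<eta> where "\<eta> n t = flat 0 (real (Suc n) * t + - (real (Suc n) * p))
        * flat 0 (- real (Suc n) * t + real (Suc n) * q)" for n t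
    have smooth: "smooth (\<eta> n)" for n
      unfolding \<eta>_def by (intro smooth_mult smooth_affine smooth_flat)
    have supp: "\<eta> n t = 0" if "t \<notin> {p<..<q}" for n t
    proof -
      have "real (Suc n) * t \<le> real (Suc n) * p \<or> real (Suc n) * q \<le> real (Suc n) * t"
        using that by (auto intro: mult_left_mono simp del: of_nat_Suc)
      then show ?thesis by (auto simp: \<eta>_def flat_def simp del: of_nat_Suc)
    qed
    have bound: "\<bar>\<eta> n t\<bar> \<le> 1" for n t
      by (auto simp: \<eta>_def flat_def abs_mult mult_le_one intro!: mult_le_one)
    have lim: "(\<lambda>n. \<eta> n t) \<longlonglongrightarrow> indicat_real {p<..<q} t" for t
    proof (cases "t \<in> {p<..<q}")
      case True
      have one: "(\<lambda>n. flat 0 (real (Suc n) * x)) \<longlonglongrightarrow> 1" if "x > 0" for x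
      proof -
        have "(\<lambda>n. exp (- (inverse (real (Suc n)) * (1 / x)))) \<longlonglongrightarrow> exp (- (0 * (1 / x)))"
          by (intro tendsto_intros LIMSEQ_inverse_real_of_nat)
        moreover have "flat 0 (real (Suc n) * x) = exp (- (inverse (real (Suc n)) * (1 / x)))" for n
        proof -
          have "real (Suc n) * x > 0" using that by simp
          then show ?thesis using that unfolding flat_def by (simp add: field_simps)
        qed
        ultimately show ?thesis by simp
      qed
      have "(\<lambda>n. flat 0 (real (Suc n) * (t - p)) * flat 0 (real (Suc n) * (q - t))) \<longlonglongrightarrow> 1 * 1"
        using True by (intro tendsto_mult one) auto
      moreover have "\<eta> n t = flat 0 (real (Suc n) * (t - p)) * flat 0 (real (Suc n) * (q - t))" for n
        unfolding \<eta>_def by (simp add: algebra_simps)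
      ultimately show ?thesis using True by simp
    qed (simp add: supp)
    have [measurable]: "\<eta> n \<in> borel_measurable borel" for n
      by (intro borel_measurable_continuous_onI smooth_continuous smooth)
    have "(LINT t|lborel. \<eta> n t * inner f (V t)) = 0" for n
    proof -
      have "times_differentiable (Suc 0) (\<eta> n)" using smooth unfolding smooth_def by blast
      then obtain \<eta>' where "\<And>t. (\<eta> n has_vector_derivative \<eta>' t) (at t)" by auto
      then have "bump I (\<eta> n) \<eta>'"
        unfolding bump_def using pq smooth supp[of _ n]
        by (intro conjI exI[of _ p] exI[of _ q]) auto
      from orth[OF this that] show ?thesis .
    qed
    moreover have "(\<lambda>n. LINT t|lborel. \<eta> n t * inner f (V t))
        \<longlonglongrightarrow> (LINT t|lborel. indicat_real {p<..<q} t * inner f (V t))"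
    proof (rule integral_dominated_convergence)
      show "integrable lborel (\<lambda>t. norm (inner f (indicat_real {p<..<q} t *\<^sub>R V t)))"
        using int[of p q] unfolding set_integrable_def
        by (intro integrable_norm integrable_inner_right) auto
      show "AE t in lborel. (\<lambda>n. \<eta> n t * inner f (V t)) \<longlonglongrightarrow> indicat_real {p<..<q} t * inner f (V t)"
        by (intro AE_I2 tendsto_mult lim tendsto_const)
      show "AE t in lborel. norm (\<eta> n t * inner f (V t)) \<le> norm (inner f (indicat_real {p<..<q} t *\<^sub>R V t))"
        for n
      proof (rule AE_I2)
        fix t
        show "norm (\<eta> n t * inner f (V t)) \<le> norm (inner f (indicat_real {p<..<q} t *\<^sub>R V t))"
          using bound[of n t] supp[of t n]
          by (cases "t \<in> {p<..<q}") (auto simp: abs_mult intro: mult_left_le_one_le)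
      qed
    qed auto
    ultimately have "(LINT t|lborel. indicat_real {p<..<q} t * inner f (V t)) = 0"
      by (simp add: LIMSEQ_const_iff)
    moreover have "(LINT t|lborel. indicat_real {p<..<q} t * inner f (V t)) = inner f ?w"
      using int[of p q] unfolding set_integrable_def set_lebesgue_integral_def
      by (subst integral_inner_right[symmetric]) auto
    ultimately show ?thesis by simp
  qed
  then have "closure D \<subseteq> {f. inner f ?w = 0}"
    by (intro closure_minimal closed_Collect_eq continuous_intros) auto
  then have "inner ?w ?w = 0" using dense by blast
  then show "?w = 0" by simp
qed

text \<open>A square integrable function with zero weak derivative on an unbounded interval is zero. If
  \<open>E\<close> is an antiderivative of the bump \<open>\<eta>\<close>, then \<open>E (t - s) - E t\<close> is again a bump, whose derivative is
  the difference of a translate of \<open>\<eta>\<close> and \<open>\<eta>\<close>. So the integral of \<open>\<eta> g\<close> does not change when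
  \<open>\<eta>\<close> is moved towards infinity, where \<open>g\<close> has arbitrarily little mass.\<close>

lemma vanishes_if_orthogonal_to_bump_derivatives:
  fixes g :: "real \<Rightarrow> real"
  assumes I: "is_interval I" and d: "d \<noteq> 0"
    and shift: "\<And>t s. t \<in> I \<Longrightarrow> s \<ge> 0 \<Longrightarrow> t + s * d \<in> I"
    and g: "g \<in> borel_measurable lborel" "integrable lborel (\<lambda>t. (g t)\<^sup>2)"
    and orth: "\<And>\<psi> \<psi>'. bump I \<psi> \<psi>' \<Longrightarrow> (LINT t|lborel. \<psi>' t * g t) = 0"
    and bump: "bump I \<eta> \<eta>'"
  shows "(LINT t|lborel. \<eta> t * g t) = 0"
proof -
  have [measurable]: "g \<in> borel_measurable borel" using g by simp
  obtain p q where pq: "p \<le> q" "{p..q} \<subseteq> I" and supp: "\<And>t. t \<notin> {p..q} \<Longrightarrow> \<eta> t = 0"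
    and sm: "smooth \<eta>"
    using bump unfolding bump_def by blast
  have cont: "continuous_on UNIV \<eta>" by (rule smooth_continuous[OF sm])
  then have [measurable]: "\<eta> \<in> borel_measurable borel" by (rule borel_measurable_continuous_onI)
  have "bounded (\<eta> ` {p..q})"
    by (intro compact_imp_bounded compact_continuous_image continuous_on_subset[OF cont]) auto
  then obtain M where "\<And>t. t \<in> {p..q} \<Longrightarrow> \<bar>\<eta> t\<bar> \<le> M"
    unfolding bounded_iff by (metis imageI real_norm_def)
  with supp pq(1) have M: "\<bar>\<eta> t\<bar> \<le> M * indicat_real {p..q} t" for t
    by (cases "t \<in> {p..q}") auto
  obtain E where E: "\<And>t. (E has_vector_derivative \<eta> t) (at t)"
    using einterval_antiderivative[of "-\<infinity>" "\<infinity>" \<eta>] cont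
    by (auto simp: continuous_on_eq_continuous_at)
  have smE: "smooth E" by (rule smooth_antiderivative[OF sm E])
  have E_right: "E x = E y" if "x > q" "y > q" for x y
  proof -
    obtain c where "\<And>x. x \<in> {q<..} \<Longrightarrow> E x = c"
    proof (rule has_vector_derivative_zero_constant)
      fix x assume "x \<in> {q<..}"
      then have "\<eta> x = 0" by (intro supp) auto
      then show "(E has_vector_derivative 0) (at x within {q<..})"
        using has_vector_derivative_at_within[OF E[of x]] by simp
    qed blast+
    with that show ?thesis by auto
  qed
  have E_left: "E x = E y" if "x < p" "y < p" for x y
  proof -
    obtain c where "\<And>x. x \<in> {..<p} \<Longrightarrow> E x = c"
    proof (rule has_vector_derivative_zero_constant)
      fix x assume "x \<in> {..<p}"
      then have "\<eta> x = 0" by (intro supp) auto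
      then show "(E has_vector_derivative 0) (at x within {..<p})"
        using has_vector_derivative_at_within[OF E[of x]] by simp
    qed blast+
    with that show ?thesis by auto
  qed
  have int_shifted: "integrable lborel (\<lambda>t. \<eta> (t - s) * g t)" for s
  proof (rule Bochner_Integration.integrable_bound)
    show "integrable lborel (\<lambda>t. M\<^sup>2 * indicat_real {p + s..q + s} t + (g t)\<^sup>2)"
      using pq(1)
      by (intro Bochner_Integration.integrable_add g integrable_mult_right integrable_real_indicator) auto
    show "AE t in lborel. norm (\<eta> (t - s) * g t) \<le> norm (M\<^sup>2 * indicat_real {p + s..q + s} t + (g t)\<^sup>2)"
    proof (rule AE_I2)
      fix t
      have "\<bar>\<eta> (t - s)\<bar> * \<bar>g t\<bar> \<le> (\<eta> (t - s))\<^sup>2 + (g t)\<^sup>2"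
        using sum_squares_bound[of "\<bar>\<eta> (t - s)\<bar>" "\<bar>g t\<bar>"]
          mult_nonneg_nonneg[OF abs_ge_zero[of "\<eta> (t - s)"] abs_ge_zero[of "g t"]]
        by (simp, linarith)
      moreover have "(\<eta> (t - s))\<^sup>2 \<le> M\<^sup>2 * indicat_real {p + s..q + s} t"
        using M[of "t - s"] power_mono[of "\<bar>\<eta> (t - s)\<bar>" M 2]
        by (auto simp: indicator_def split: if_splits)
      ultimately show "norm (\<eta> (t - s) * g t) \<le> norm (M\<^sup>2 * indicat_real {p + s..q + s} t + (g t)\<^sup>2)"
        by (simp add: abs_mult)
    qed
  qed auto
  define K where "K = (LINT t|lborel. \<eta> t * g t)"
  have K: "K = (LINT t|lborel. \<eta> (t - s * d) * g t)" if "s \<ge> 0" for s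
  proof -
    let ?\<psi> = "\<lambda>t. E (t - s * d) - E t" and ?\<psi>' = "\<lambda>t. \<eta> (t - s * d) - \<eta> t"
    have "smooth ?\<psi>"
      using smooth_diff[OF smooth_affine[OF smE, of 1 "- (s * d)"] smE] by simp
    moreover have "(?\<psi> has_vector_derivative ?\<psi>' t) (at t)" for t
    proof -
      have "((\<lambda>t. t - s * d) has_vector_derivative 1) (at t)"
        by (auto intro!: derivative_eq_intros)
      from vector_diff_chain_at[OF this E] have "((\<lambda>t. E (t - s * d)) has_vector_derivative \<eta> (t - s * d)) (at t)"
        by (simp add: o_def)
      from has_vector_derivative_diff[OF this E] show ?thesis .
    qed
    moreover have "{min p (p + s * d)..max q (q + s * d)} \<subseteq> I"
    proof -
      have "p \<in> I" "q \<in> I" using pq by auto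
      then have ends: "min p (p + s * d) \<in> I" "max q (q + s * d) \<in> I"
        using shift[OF _ that, of p] shift[OF _ that, of q] by (auto simp: min_def max_def)
      show ?thesis
        by (rule subsetI, rule mem_is_interval_1_I[OF I ends]) simp_all
    qed
    moreover have "?\<psi> t = 0" if "t \<notin> {min p (p + s * d)..max q (q + s * d)}" for t
    proof -
      have "t < p \<and> t - s * d < p \<or> q < t \<and> q < t - s * d"
        using that by auto
      then show ?thesis using E_left E_right by auto
    qed
    ultimately have "bump I ?\<psi> ?\<psi>'"
      unfolding bump_def using pq(1)
      by (intro conjI exI[of _ "min p (p + s * d)"] exI[of _ "max q (q + s * d)"]) auto
    from orth[OF this] show ?thesis
      using int_shifted[of "s * d"] int_shifted[of 0] by (simp add: K_def left_diff_distrib)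
  qed
  \<comment> \<open>The Cauchy-Schwarz estimate in additive form, \<open>M x \<le> e + (M\<^sup>2 / (4 e)) x\<^sup>2\<close>: the first term costs
    \<open>e\<close> times the length of the support, and the second one is a tail \<open>R n\<close> of the integral of \<open>g\<^sup>2\<close>.\<close>
  have "\<bar>K\<bar> \<le> e * (q - p)" if "e > 0" for e
  proof -
    define C where "C = M\<^sup>2 / (4 * e)"
    define R where "R n = (LINT t|lborel. indicat_real {p + real n * d..q + real n * d} t * (C * (g t)\<^sup>2))" for n
    have int_R: "integrable lborel (\<lambda>t. indicat_real {p + real n * d..q + real n * d} t * (C * (g t)\<^sup>2))" for n
      using integrable_mult_indicator[of "{p + real n * d..q + real n * d}" lborel "\<lambda>t. C * (g t)\<^sup>2"] g(2)
      by simp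
    have "\<bar>K\<bar> \<le> e * (q - p) + R n" for n
    proof -
      have pt: "norm (\<eta> (t - real n * d) * g t) \<le> e * indicat_real {p + real n * d..q + real n * d} t
          + indicat_real {p + real n * d..q + real n * d} t * (C * (g t)\<^sup>2)" for t
      proof (cases "t \<in> {p + real n * d..q + real n * d}")
        case True
        have "\<bar>\<eta> (t - real n * d) * g t\<bar> \<le> M * \<bar>g t\<bar>"
          using M[of "t - real n * d"] True
          by (auto simp: abs_mult indicator_def intro!: mult_right_mono split: if_splits)
        also have "M * \<bar>g t\<bar> \<le> e + C * (g t)\<^sup>2"
        proof -
          have "0 \<le> (2 * e - M * \<bar>g t\<bar>)\<^sup>2" by simp
          also have "\<dots> = 4 * e\<^sup>2 - 4 * e * (M * \<bar>g t\<bar>) + M\<^sup>2 * (g t)\<^sup>2"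
            by (simp add: power2_diff power_mult_distrib)
          finally have "4 * e * (M * \<bar>g t\<bar>) \<le> 4 * e\<^sup>2 + M\<^sup>2 * (g t)\<^sup>2" by simp
          also have "M\<^sup>2 = 4 * e * C" using \<open>e > 0\<close> by (simp add: C_def)
          also have "4 * e\<^sup>2 + 4 * e * C * (g t)\<^sup>2 = 4 * e * (e + C * (g t)\<^sup>2)"
            by (simp add: algebra_simps power2_eq_square)
          finally have "4 * e * (M * \<bar>g t\<bar>) \<le> 4 * e * (e + C * (g t)\<^sup>2)" .
          then show ?thesis using \<open>e > 0\<close> by simp
        qed
        finally show ?thesis using True by simp
      next
        case False
        then show ?thesis using supp[of "t - real n * d"] by auto
      qed
      have "\<bar>K\<bar> \<le> (LINT t|lborel. norm (\<eta> (t - real n * d) * g t))"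
        using K[of "real n"] integral_norm_bound[of lborel "\<lambda>t. \<eta> (t - real n * d) * g t"] by simp
      also have "\<dots> \<le> (LINT t|lborel. e * indicat_real {p + real n * d..q + real n * d} t
          + indicat_real {p + real n * d..q + real n * d} t * (C * (g t)\<^sup>2))"
        using pq(1)
        by (intro integral_mono integrable_norm int_shifted Bochner_Integration.integrable_add int_R
            integrable_mult_right integrable_real_indicator pt) auto
      also have "\<dots> = e * (q - p) + R n"
        using pq(1) int_R[of n] by (subst Bochner_Integration.integral_add) (auto simp: R_def)
      finally show ?thesis .
    qed
    moreover have "R \<longlonglongrightarrow> 0"
    proof -
      have "R \<longlonglongrightarrow> (LINT t::real|lborel. 0)"
        unfolding R_def
      proof (rule integral_dominated_convergence)
        show "integrable lborel (\<lambda>t. C * (g t)\<^sup>2)" using g(2) by simp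
        show "AE t in lborel. norm (indicat_real {p + real n * d..q + real n * d} t * (C * (g t)\<^sup>2))
            \<le> C * (g t)\<^sup>2" for n
          using \<open>e > 0\<close> by (auto simp: indicator_def C_def)
        show "AE t in lborel. (\<lambda>n. indicat_real {p + real n * d..q + real n * d} t * (C * (g t)\<^sup>2)) \<longlonglongrightarrow> 0"
        proof (rule AE_I2)
          fix t
          obtain N where N: "(\<bar>t\<bar> + \<bar>p\<bar> + \<bar>q\<bar>) / \<bar>d\<bar> < real N"
            using reals_Archimedean2 by blast
          have "indicat_real {p + real n * d..q + real n * d} t = 0" if "n \<ge> N" for n
          proof -
            have "(\<bar>t\<bar> + \<bar>p\<bar> + \<bar>q\<bar>) / \<bar>d\<bar> < real n" using N that by linarith
            then have "\<bar>t\<bar> + \<bar>p\<bar> + \<bar>q\<bar> < \<bar>real n * d\<bar>"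
              using d by (simp add: field_simps abs_mult)
            then have "t \<notin> {p + real n * d..q + real n * d}" by auto
            then show ?thesis by simp
          qed
          then show "(\<lambda>n. indicat_real {p + real n * d..q + real n * d} t * (C * (g t)\<^sup>2)) \<longlonglongrightarrow> 0"
            by (intro tendsto_eventually) (auto simp: eventually_sequentially intro!: exI[of _ N])
        qed
      qed auto
      then show ?thesis by simp
    qed
    ultimately have "\<bar>K\<bar> \<le> e * (q - p) + 0"
      by (intro LIMSEQ_le_const[OF tendsto_add[OF tendsto_const]]) auto
    then show ?thesis by simp
  qed
  have "\<bar>K\<bar> \<le> 0"
  proof (rule field_le_epsilon)
    fix e :: real assume "e > 0"
    have "\<bar>K\<bar> \<le> e / (q - p + 1) * (q - p)"
      using \<open>e > 0\<close> pq(1) by (intro \<open>\<And>e. e > 0 \<Longrightarrow> \<bar>K\<bar> \<le> e * (q - p)\<close>) auto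
    also have "\<dots> \<le> e" using \<open>e > 0\<close> pq(1) by (simp add: field_simps)
    finally show "\<bar>K\<bar> \<le> 0 + e" by simp
  qed
  then show ?thesis by (simp add: K_def)
qed

section \<open>Complex inner products\<close>

instance chilbert_space \<subseteq> banach ..

lemma cinner_scaleC_right: "cinner x (c *\<^sub>C y) = cnj c * cinner x y"
  by (subst cinner_commute) (simp add: cinner_scaleC_left flip: cinner_commute[of x y])

lemma cinner_add_right: "cinner x (y + z) = cinner x y + cinner x z"
  by (subst cinner_commute)
    (simp add: cinner_add_left flip: cinner_commute[of x y] cinner_commute[of x z])

lemma cinner_zero_right: "cinner x 0 = 0"
  using cinner_add_right[of x 0 0] by simp

lemma scaleC_minus_one: "(- 1) *\<^sub>C x = - x" for x :: "'a::complex_inner"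
  using scaleC_of_real[of "-1" x] by simp

lemma cinner_minus_left: "cinner (- x) y = - cinner x y"
  using cinner_scaleC_left[of "- 1" x y] by (simp add: scaleC_minus_one)

lemma cinner_minus_right: "cinner x (- y) = - cinner x y"
  using cinner_scaleC_right[of x "- 1" y] by (simp add: scaleC_minus_one)

lemma cinner_diff_left: "cinner (x - y) z = cinner x z - cinner y z"
  using cinner_add_left[of x "- y" z] by (simp add: cinner_minus_left)

lemma cinner_diff_right: "cinner x (y - z) = cinner x y - cinner x z"
  using cinner_add_right[of x y "- z"] by (simp add: cinner_minus_right)

lemma cinner_zero_left: "cinner 0 x = 0"
  using cinner_diff_left[of x x x] by simp

lemma cinner_self: "cinner x x = complex_of_real ((norm x)\<^sup>2)"
  using cinner_commute[of x x] inner_eq_Re_cinner[of x x]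
  by (auto simp: complex_eq_iff power2_norm_eq_inner)


section \<open>Eigenvectors of normal operators\<close>

text \<open>With \<open>w = N\<^sup>* u\<close>, the pairing \<open>\<langle>N u, u\<rangle> = \<langle>u, w\<rangle>\<close> together with \<open>\<parallel>w\<parallel> = \<parallel>N u\<parallel>\<close> turns the
  expansion of \<open>\<parallel>w - cnj \<mu> u\<parallel>\<^sup>2\<close> into zero.\<close>

lemma formally_normal_eigenvector:
  assumes N: "formally_normal_in X N" and eig: "(u, \<mu> *\<^sub>C u) \<in> N"
  shows "(u, cnj \<mu> *\<^sub>C u) \<in> adjoint_in X N"
proof -
  obtain w where w: "(u, w) \<in> adjoint_in X N"
    using N eig unfolding formally_normal_in_def by blast
  have norm_w: "norm w = cmod \<mu> * norm u"
    using N eig w unfolding formally_normal_in_def by (metis norm_scaleC)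
  have uw: "\<mu> * cinner u u = cinner u w"
    using w eig unfolding adjoint_in_def by (fastforce simp: cinner_scaleC_left)
  have wu: "cinner w u = cnj \<mu> * cinner u u"
    using arg_cong[OF uw, of cnj] cinner_commute[of w u] cinner_commute[of u u] by simp
  have "cinner (w - cnj \<mu> *\<^sub>C u) (w - cnj \<mu> *\<^sub>C u)
      = cinner w w - \<mu> * cinner w u - cnj \<mu> * cinner u w + cnj \<mu> * \<mu> * cinner u u"
    by (simp add: cinner_diff_left cinner_diff_right cinner_scaleC_left cinner_scaleC_right algebra_simps)
  also have "\<dots> = cinner w w - \<mu> * cnj \<mu> * cinner u u"
    by (simp add: wu flip: uw)
  also have "\<dots> = 0"
    by (simp add: cinner_self norm_w power_mult_distrib complex_norm_square flip: of_real_power)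
  finally have "w = cnj \<mu> *\<^sub>C u" by (simp add: cinner_self)
  with w show ?thesis by simp
qed

text \<open>Here \<open>y\<close> is the value of a formal adjoint of \<open>S\<close> at \<open>x\<close>. Since \<open>x\<close> lies in the domain of \<open>N\<^sup>*\<close> and the domain
  of \<open>S\<close> is total, \<open>y\<close> must be \<open>N\<^sup>* x\<close>. So \<open>\<langle>x', u\<rangle> = \<langle>x, N\<^sup>* u\<rangle> = \<mu> \<langle>x, u\<rangle>\<close>
  and \<open>\<langle>y, u\<rangle> = \<langle>x, N u\<rangle> = cnj \<mu> \<langle>x, u\<rangle>\<close>, and the identity is the difference of the two.\<close>

lemma normal_eigenvector_identity:
  assumes N: "formally_normal_in X N"
    and X: "\<And>v w. v \<in> X \<Longrightarrow> w \<in> X \<Longrightarrow> v - w \<in> X"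
    and S: "S \<subseteq> N" and total: "\<And>w. w \<in> X \<Longrightarrow> (\<And>z z'. (z, z') \<in> S \<Longrightarrow> cinner z w = 0) \<Longrightarrow> w = 0"
    and x: "(x, x') \<in> S" and y: "y \<in> X" "\<And>z z'. (z, z') \<in> S \<Longrightarrow> cinner z' x = cinner z y"
    and eig: "(u, \<mu> *\<^sub>C u) \<in> N"
  shows "cinner (x' - y) u = 2 * \<i> * Im \<mu> * cinner x u"
proof -
  obtain v where v: "(x, v) \<in> adjoint_in X N"
    using N S x unfolding formally_normal_in_def by blast
  have "v - y = 0"
  proof (rule total)
    show "v - y \<in> X" using v y(1) by (auto simp: adjoint_in_def intro: X)
    fix z z' assume z: "(z, z') \<in> S"
    then have "cinner z' x = cinner z v" using v S unfolding adjoint_in_def by blast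
    with y(2)[OF z] show "cinner z (v - y) = 0" by (simp add: cinner_diff_right)
  qed
  with v eig have "cinner (\<mu> *\<^sub>C u) x = cinner u y" unfolding adjoint_in_def by auto
  from arg_cong[OF this, of cnj] have 1: "cinner y u = cnj \<mu> * cinner x u"
    using cinner_commute[of x u] cinner_commute[of y u] by (simp add: cinner_scaleC_left)
  have "cinner x' u = cinner x (cnj \<mu> *\<^sub>C u)"
    using formally_normal_eigenvector[OF N eig] S x unfolding adjoint_in_def by blast
  then have 2: "cinner x' u = \<mu> * cinner x u" by (simp add: cinner_scaleC_right)
  have "cinner (x' - y) u = (\<mu> - cnj \<mu>) * cinner x u"
    by (simp add: cinner_diff_left 1 2 algebra_simps)
  then show ?thesis by (simp add: complex_diff_cnj mult.commute mult.left_commute)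
qed


section \<open>Elementary tensors and the minimal operators\<close>

definition tensor :: "(real \<Rightarrow> complex) \<Rightarrow> 'h \<Rightarrow> 'h::{complex_inner, second_countable_topology} l2" where
  "tensor \<phi> f = abs_l2 (\<lambda>t. \<phi> t *\<^sub>C f)"

lemma bump_integrable:
  fixes \<phi> :: "real \<Rightarrow> 'a::{banach, second_countable_topology}"
  assumes "bump I \<phi> \<phi>'"
  shows "integrable lborel \<phi>"
proof -
  obtain p q where supp: "\<And>t. t \<notin> {p..q} \<Longrightarrow> \<phi> t = 0" and "smooth \<phi>"
    using assms unfolding bump_def by blast
  then have "set_integrable lborel {p..q} \<phi>"
    by (intro borel_integrable_atLeastAtMost' smooth_continuous)
  moreover have "indicat_real {p..q} t *\<^sub>R \<phi> t = \<phi> t" for t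
    using supp[of t] by (cases "t \<in> {p..q}") auto
  ultimately show ?thesis by (simp add: set_integrable_def)
qed

lemma bump_mult:
  fixes \<phi> \<psi> :: "real \<Rightarrow> 'a::real_normed_algebra"
  assumes "bump I \<phi> \<phi>'" "smooth \<psi>" "\<And>t. (\<psi> has_vector_derivative \<psi>' t) (at t)"
  shows "bump I (\<lambda>t. \<phi> t * \<psi> t) (\<lambda>t. \<phi> t * \<psi>' t + \<phi>' t * \<psi> t)"
  unfolding bump_def
proof (intro conjI allI)
  show "smooth (\<lambda>t. \<phi> t * \<psi> t)"
    using assms by (intro smooth_mult) (auto simp: bump_def)
  show "((\<lambda>t. \<phi> t * \<psi> t) has_vector_derivative \<phi> t * \<psi>' t + \<phi>' t * \<psi> t) (at t)" for t
    using assms by (intro has_vector_derivative_mult) (auto simp: bump_def)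
  obtain p q where "p \<le> q" "{p..q} \<subseteq> I" "\<And>t. t \<notin> {p..q} \<Longrightarrow> \<phi> t = 0"
    using assms unfolding bump_def by blast
  then show "\<exists>p q. p \<le> q \<and> {p..q} \<subseteq> I \<and> (\<forall>t. t \<notin> {p..q} \<longrightarrow> \<phi> t * \<psi> t = 0)"
    by (metis mult_zero_left)
qed

lemma bump_bounded_linear:
  assumes "bounded_linear h" "bump I \<phi> \<phi>'"
  shows "bump I (\<lambda>t. h (\<phi> t)) (\<lambda>t. h (\<phi>' t))"
  unfolding bump_def
proof (intro conjI allI)
  show "smooth (\<lambda>t. h (\<phi> t))"
    using assms by (auto simp: bump_def intro: smooth_bounded_linear[OF assms(1)])
  show "((\<lambda>t. h (\<phi> t)) has_vector_derivative h (\<phi>' t)) (at t)" for t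
    using assms by (intro bounded_linear.has_vector_derivative[OF assms(1)]) (auto simp: bump_def)
  obtain p q where "p \<le> q" "{p..q} \<subseteq> I" "\<And>t. t \<notin> {p..q} \<Longrightarrow> \<phi> t = 0"
    using assms unfolding bump_def by blast
  then show "\<exists>p q. p \<le> q \<and> {p..q} \<subseteq> I \<and> (\<forall>t. t \<notin> {p..q} \<longrightarrow> h (\<phi> t) = 0)"
    using linear_0[OF bounded_linear.linear[OF assms(1)]] by metis
qed

lemma square_integrable_tensor:
  assumes "bump I \<phi> \<phi>'"
  shows "square_integrable (\<lambda>t. \<phi> t *\<^sub>C f)"
  unfolding square_integrable_def
proof
  have "continuous_on UNIV \<phi>" using assms by (intro smooth_continuous) (auto simp: bump_def)
  then have [measurable]: "\<phi> \<in> borel_measurable borel" by (rule borel_measurable_continuous_onI)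
  have "\<phi> t *\<^sub>C f = Re (\<phi> t) *\<^sub>R f + Im (\<phi> t) *\<^sub>R (\<i> *\<^sub>C f)" for t
    by (subst complex_eq[of "\<phi> t"]) (simp add: scaleC_add_left mult.commute[of \<i>]
      scaleC_of_real flip: scaleC_scaleC)
  then show "(\<lambda>t. \<phi> t *\<^sub>C f) \<in> borel_measurable lborel" by simp
  have d: "((\<lambda>t. cnj (\<phi> t)) has_vector_derivative cnj (\<phi>' t)) (at t)" for t
    using bump_bounded_linear[OF bounded_linear_cnj assms] by (auto simp: bump_def)
  have "smooth (\<lambda>t. cnj (\<phi> t))"
    using bump_bounded_linear[OF bounded_linear_cnj assms] by (auto simp: bump_def)
  from integrable_Re[OF bump_integrable[OF bump_mult[OF assms this d]]]
  have "integrable lborel (\<lambda>t. Re (\<phi> t * cnj (\<phi> t)))" .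
  moreover have "Re (\<phi> t * cnj (\<phi> t)) = (cmod (\<phi> t))\<^sup>2" for t
    by (simp only: complex_norm_square[symmetric] Re_complex_of_real)
  ultimately have "integrable lborel (\<lambda>t. (cmod (\<phi> t))\<^sup>2)" by simp
  then show "integrable lborel (\<lambda>t. (norm (\<phi> t *\<^sub>C f))\<^sup>2)"
    by (simp add: norm_scaleC power_mult_distrib)
qed

lemma cinner_tensor_abs:
  assumes "bump I \<phi> \<phi>'" "square_integrable U"
  shows "cinner (tensor \<phi> f) (abs_l2 U) = (LINT t|lborel. \<phi> t * cinner f (U t))"
    and "integrable lborel (\<lambda>t. \<phi> t * cinner f (U t))"
  using assms square_integrable_tensor[OF assms(1), of f]
    integrable_cinner[OF square_integrable_tensor[OF assms(1), of f] assms(2)]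
  by (simp_all add: tensor_def cinner_l2.abs_eq cinner_scaleC_left)

lemma tensor_in_L2:
  assumes "bump I \<phi> \<phi>'"
  shows "tensor \<phi> f \<in> L2 I"
proof -
  have "\<phi> t = 0" if "t \<notin> I" for t using assms that unfolding bump_def by blast
  moreover have "0 *\<^sub>C f = 0" using scaleC_of_real[of 0 f] by simp
  ultimately show ?thesis
    using square_integrable_tensor[OF assms, of f] by (auto simp: L2_def tensor_def l2_on.abs_eq)
qed

lemma integral_bump_derivative:
  fixes F :: "real \<Rightarrow> complex"
  assumes "bump I F F'"
  shows "integral\<^sup>L lborel F' = 0"
proof -
  obtain p q where pq: "p \<le> q" and supp: "\<And>t. t \<notin> {p..q} \<Longrightarrow> F t = 0"
    and d: "\<And>t. (F has_vector_derivative F' t) (at t)"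
    using assms unfolding bump_def by blast
  have F': "F' t = 0" if "t \<notin> {p..q}" for t
    by (rule derivative_zero_off_support[OF d supp that])
  obtain F'' where "bump I F' F''" using bump_derivative[OF assms] by blast
  then have cont: "continuous_on {p - 1..q + 1} F'" by (intro smooth_continuous) (auto simp: bump_def)
  have "(LINT t|lborel. indicat_real {p - 1..q + 1} t *\<^sub>R F' t) = F (q + 1) - F (p - 1)"
    by (rule integral_FTC_Icc) (use pq cont d in \<open>auto intro: has_vector_derivative_at_within\<close>)
  moreover have "indicat_real {p - 1..q + 1} t *\<^sub>R F' t = F' t" for t
    using F'[of t] by (cases "t \<in> {p - 1..q + 1}") auto
  ultimately show ?thesis using supp[of "q + 1"] supp[of "p - 1"] by simp
qed

text \<open>Integration by parts; there are no boundary terms as bumps have compact support.\<close>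

lemma tensor_formally_skew:
  assumes \<phi>: "bump I \<phi> \<phi>'" and \<psi>: "bump I \<psi> \<psi>'"
  shows "cinner (tensor \<phi>' f) (tensor \<psi> k) = - cinner (tensor \<phi> f) (tensor \<psi>' k)"
proof -
  obtain \<phi>'' \<psi>'' where \<phi>': "bump I \<phi>' \<phi>''" and \<psi>': "bump I \<psi>' \<psi>''"
    using bump_derivative[OF \<phi>] bump_derivative[OF \<psi>] by blast
  have cnj: "bump I (\<lambda>t. cnj (\<psi> t)) (\<lambda>t. cnj (\<psi>' t))"
    by (rule bump_bounded_linear[OF bounded_linear_cnj \<psi>])
  have "bump I (\<lambda>t. \<phi> t * cnj (\<psi> t)) (\<lambda>t. \<phi> t * cnj (\<psi>' t) + \<phi>' t * cnj (\<psi> t))"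
    using cnj by (intro bump_mult[OF \<phi>]) (auto simp: bump_def)
  from bump_bounded_linear[OF bounded_linear_mult_left[of "cinner f k"] this]
  have "(LINT t|lborel. (\<phi> t * cnj (\<psi>' t) + \<phi>' t * cnj (\<psi> t)) * cinner f k) = 0"
    by (rule integral_bump_derivative)
  moreover have "(LINT t|lborel. (\<phi> t * cnj (\<psi>' t) + \<phi>' t * cnj (\<psi> t)) * cinner f k)
      = (LINT t|lborel. \<phi> t * cinner f (\<psi>' t *\<^sub>C k)) + (LINT t|lborel. \<phi>' t * cinner f (\<psi> t *\<^sub>C k))"
    using cinner_tensor_abs(2)[OF \<phi> square_integrable_tensor[OF \<psi>', of k], of f]
      cinner_tensor_abs(2)[OF \<phi>' square_integrable_tensor[OF \<psi>, of k], of f]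
    by (simp add: cinner_scaleC_right algebra_simps flip: Bochner_Integration.integral_add)
  ultimately have "(LINT t|lborel. \<phi> t * cinner f (\<psi>' t *\<^sub>C k))
      + (LINT t|lborel. \<phi>' t * cinner f (\<psi> t *\<^sub>C k)) = 0" by (simp only:)
  then show ?thesis
    using cinner_tensor_abs(1)[OF \<phi> square_integrable_tensor[OF \<psi>', of k], of f]
      cinner_tensor_abs(1)[OF \<phi>' square_integrable_tensor[OF \<psi>, of k], of f]
    unfolding tensor_def[of \<psi>] tensor_def[of \<psi>'] by (simp add: add_eq_0_iff)
qed

lemma cinner_tensor_tensor:
  assumes \<phi>: "bump I \<phi> \<phi>'" and \<psi>: "bump I \<psi> \<psi>'" and "cinner g k = cinner f l"
  shows "cinner (tensor \<phi> g) (tensor \<psi> k) = cinner (tensor \<phi> f) (tensor \<psi> l)"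
  unfolding tensor_def[of \<psi>] cinner_tensor_abs(1)[OF \<phi> square_integrable_tensor[OF \<psi>]]
  using assms(3) by (simp add: cinner_scaleC_right)

text \<open>The part of the minimal operator that is needed: single tensors instead of finite sums, with
  bumps instead of general test functions. Its domain is still total, which is what pins down the
  adjoint of a normal extension on it.\<close>

definition bump_operator ::
    "('h::{complex_inner, second_countable_topology} \<times> 'h) set \<Rightarrow> real set \<Rightarrow> ('h l2 \<times> 'h l2) set" where
  "bump_operator A I =
     {(tensor \<phi> f, tensor \<phi>' f + tensor \<phi> g) | \<phi> \<phi>' f g. bump I \<phi> \<phi>' \<and> (f, g) \<in> A}"

lemma bump_operatorI:
  "bump I \<phi> \<phi>' \<Longrightarrow> (f, g) \<in> A \<Longrightarrow> (tensor \<phi> f, tensor \<phi>' f + tensor \<phi> g) \<in> bump_operator A I"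
  unfolding bump_operator_def by blast

lemma bump_operator_subset_minimal: "bump_operator A I \<subseteq> minimal_operator A I"
proof -
  have "(tensor \<phi> f, tensor \<phi>' f + tensor \<phi> g) \<in> preminimal_operator A I"
    if \<phi>: "bump I \<phi> \<phi>'" and fg: "(f, g) \<in> A" for \<phi> \<phi>' f g
  proof -
    obtain \<phi>'' where \<phi>': "bump I \<phi>' \<phi>''" using bump_derivative[OF \<phi>] by blast
    have vd: "vector_derivative \<phi> (at t) = \<phi>' t" for t
      using \<phi> by (intro vector_derivative_at) (auto simp: bump_def)
    have "tensor \<phi>' f + tensor \<phi> g = abs_l2 (\<lambda>t. \<phi>' t *\<^sub>C f + \<phi> t *\<^sub>C g)"
      using square_integrable_tensor[OF \<phi>, of g] square_integrable_tensor[OF \<phi>', of f]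
      by (simp add: tensor_def plus_l2.abs_eq)
    then show ?thesis
      unfolding preminimal_operator_def
      using bump_test_function[OF \<phi>] fg
      by (intro CollectI) (rule exI[of _ "1::nat"], rule exI[of _ "\<lambda>_. \<phi>"],
          rule exI[of _ "\<lambda>_. f"], rule exI[of _ "\<lambda>_. g"],
        simp add: vd, simp add: tensor_def)
  qed
  then have "bump_operator A I \<subseteq> preminimal_operator A I" unfolding bump_operator_def by blast
  then show ?thesis unfolding minimal_operator_def using closure_subset by blast
qed

lemma zero_in_minimal: "(0, 0) \<in> minimal_operator A I"
proof -
  have "(0, 0) \<in> preminimal_operator A I"
    unfolding preminimal_operator_def zero_l2_def
    by (auto simp: square_integrable_0 intro!: exI[of _ "0::nat"])
  then show ?thesis unfolding minimal_operator_def using closure_subset by blast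
qed

text \<open>The formal adjoint of \<open>d/dt + A\<close> is \<open>- d/dt + A\<close>.\<close>

lemma bump_operator_formal_adjoint:
  assumes "selfadjoint_in UNIV A" "(z, z') \<in> bump_operator A I"
    and \<psi>: "bump I \<psi> \<psi>'" and kl: "(k, l) \<in> A"
  shows "cinner z' (tensor \<psi> k) = cinner z (tensor \<psi> l - tensor \<psi>' k)"
proof -
  obtain \<phi> \<phi>' f g where \<phi>: "bump I \<phi> \<phi>'" and fg: "(f, g) \<in> A"
    and z: "z = tensor \<phi> f" "z' = tensor \<phi>' f + tensor \<phi> g"
    using assms(2) unfolding bump_operator_def by blast
  have "(k, l) \<in> adjoint_in UNIV A" using assms(1) kl unfolding selfadjoint_in_def by simp
  with fg have "cinner g k = cinner f l" unfolding adjoint_in_def by blast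
  from cinner_tensor_tensor[OF \<phi> \<psi> this] tensor_formally_skew[OF \<phi> \<psi>]
  show ?thesis by (simp add: z cinner_add_left cinner_diff_right)
qed

lemma L2_eq_zeroI:
  assumes "u \<in> L2 I" "u = abs_l2 U" "square_integrable U" "AE t in lborel. t \<in> I \<longrightarrow> U t = 0"
  shows "u = 0"
proof -
  have "AE t in lborel. t \<notin> I \<longrightarrow> U t = 0"
    using assms(1-3) by (simp add: L2_def l2_on.abs_eq)
  with assms(4) have "AE t in lborel. U t = 0" by eventually_elim auto
  then show ?thesis
    unfolding assms(2) zero_l2_def using assms(3) square_integrable_0
    by (intro Quotient3_rel_abs[OF Quotient3_l2]) auto
qed

lemma obtain_representative:
  obtains U where "u = abs_l2 U" "square_integrable U"
  by (metis Quotient3_abs_rep[OF Quotient3_l2] Quotient3_rep_reflp[OF Quotient3_l2])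

lemma L2_diff: "u \<in> L2 I \<Longrightarrow> v \<in> L2 I \<Longrightarrow> u - v \<in> L2 I"
  unfolding L2_def mem_Collect_eq minus_l2_def
  by transfer (auto elim: AE_mp)

lemma tensors_total:
  fixes u :: "'h::{chilbert_space, second_countable_topology} l2"
  assumes "open I" "closure D = UNIV" "u \<in> L2 I"
    and orth: "\<And>\<phi> \<phi>' f. bump I \<phi> \<phi>' \<Longrightarrow> f \<in> D \<Longrightarrow> cinner (tensor \<phi> f) u = 0"
  shows "u = 0"
proof -
  obtain U where U: "u = abs_l2 U" "square_integrable U" by (rule obtain_representative)
  have "AE t in lborel. t \<in> I \<longrightarrow> U t = 0"
  proof (rule vanishes_if_orthogonal_to_bumps[OF assms(1,2)])
    show "U \<in> borel_measurable lborel" "integrable lborel (\<lambda>t. (norm (U t))\<^sup>2)"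
      using U(2) by (auto simp: square_integrable_def)
    fix \<eta> \<eta>' :: "real \<Rightarrow> real" and f assume \<eta>: "bump I \<eta> \<eta>'" and f: "f \<in> D"
    have b: "bump I (\<lambda>t. complex_of_real (\<eta> t)) (\<lambda>t. complex_of_real (\<eta>' t))"
      by (rule bump_bounded_linear[OF bounded_linear_of_real \<eta>])
    have "(LINT t|lborel. complex_of_real (\<eta> t) * cinner f (U t)) = 0"
      using orth[OF b f] cinner_tensor_abs(1)[OF b U(2), of f] U(1) by simp
    then have "(LINT t|lborel. Re (complex_of_real (\<eta> t) * cinner f (U t))) = 0"
      using cinner_tensor_abs(2)[OF b U(2), of f] by (subst integral_Re) simp_all
    then show "(LINT t|lborel. \<eta> t * inner f (U t)) = 0" by (simp add: inner_eq_Re_cinner)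
  qed
  with assms(3) U show ?thesis by (blast intro: L2_eq_zeroI)
qed

text \<open>The hypothesis is a weak form of \<open>u' = i c u\<close>. Its solutions have
  constant norm in \<open>t\<close>, and such a function is square integrable on a half line only if it is zero.
  Testing with \<open>\<psi> e\<^sup>i\<^sup>c\<^sup>t\<close> amounts to passing to \<open>V = e\<^sup>-\<^sup>i\<^sup>c\<^sup>t u\<close>, whose weak derivative is zero.\<close>

lemma no_square_integrable_oscillation:
  fixes u :: "'h::{chilbert_space, second_countable_topology} l2"
  assumes I: "I = {..<a} \<or> I = {a<..}" and "closure D = UNIV" "u \<in> L2 I"
    and osc: "\<And>\<phi> \<phi>' f. bump I \<phi> \<phi>' \<Longrightarrow> f \<in> D \<Longrightarrow>
      cinner (tensor \<phi>' f) u = \<i> * complex_of_real c * cinner (tensor \<phi> f) u"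
  shows "u = 0"
proof -
  have interval: "open I" "is_interval I" using I by auto
  obtain d :: real where d: "d \<noteq> 0" "\<And>t s. t \<in> I \<Longrightarrow> s \<ge> 0 \<Longrightarrow> t + s * d \<in> I"
  proof -
    from I show ?thesis
    proof
      assume "I = {..<a}" then show ?thesis by (intro that[of "-1"]) auto
    next
      assume "I = {a<..}" then show ?thesis by (intro that[of 1]) auto
    qed
  qed
  obtain U where U: "u = abs_l2 U" "square_integrable U" by (rule obtain_representative)
  have [measurable]: "U \<in> borel_measurable borel" using U(2) by (simp add: square_integrable_def)
  define V where "V t = exp (- (\<i> * complex_of_real c) * complex_of_real t) *\<^sub>C U t" for t
  have V_eq: "V t = cos (c * t) *\<^sub>R U t + sin (c * t) *\<^sub>R ((- \<i>) *\<^sub>C U t)" for t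
  proof -
    have "exp (- (\<i> * complex_of_real c) * complex_of_real t)
        = complex_of_real (cos (c * t)) + complex_of_real (sin (c * t)) * (- \<i>)"
      by (simp add: complex_eq_iff exp_eq_polar cis.ctr Re_exp Im_exp)
    then show ?thesis unfolding V_def by (simp only: scaleC_add_left scaleC_of_real flip: scaleC_scaleC)
  qed
  have [measurable]: "V \<in> borel_measurable borel"
    unfolding V_eq[abs_def] by measurable
  have norm_V: "norm (V t) = norm (U t)" for t
    by (simp add: V_def norm_scaleC)
  have "AE t in lborel. t \<in> I \<longrightarrow> V t = 0"
  proof (rule vanishes_if_orthogonal_to_bumps[OF interval(1) assms(2)])
    show "V \<in> borel_measurable lborel" by simp
    show int: "integrable lborel (\<lambda>t. (norm (V t))\<^sup>2)"
      using U(2) by (simp add: norm_V square_integrable_def)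
    fix \<eta> \<eta>' :: "real \<Rightarrow> real" and f assume \<eta>: "bump I \<eta> \<eta>'" and f: "f \<in> D"
    show "(LINT t|lborel. \<eta> t * inner f (V t)) = 0"
    proof (rule vanishes_if_orthogonal_to_bump_derivatives[OF interval(2) d _ _ _ \<eta>])
      show "(\<lambda>t. inner f (V t)) \<in> borel_measurable lborel" by measurable
      show "integrable lborel (\<lambda>t. (inner f (V t))\<^sup>2)"
      proof (rule Bochner_Integration.integrable_bound)
        show "integrable lborel (\<lambda>t. (norm f)\<^sup>2 * (norm (V t))\<^sup>2)" using int by simp
        show "AE t in lborel. norm ((inner f (V t))\<^sup>2) \<le> norm ((norm f)\<^sup>2 * (norm (V t))\<^sup>2)"
        proof (rule AE_I2)
          fix t
          have "\<bar>inner f (V t)\<bar>\<^sup>2 \<le> (norm f * norm (V t))\<^sup>2"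
            by (intro power_mono Cauchy_Schwarz_ineq2) simp
          then show "norm ((inner f (V t))\<^sup>2) \<le> norm ((norm f)\<^sup>2 * (norm (V t))\<^sup>2)"
            by (simp add: power_mult_distrib)
        qed
      qed measurable
      fix \<psi> \<psi>' :: "real \<Rightarrow> real" assume \<psi>: "bump I \<psi> \<psi>'"
      define e where "e t = exp (\<i> * complex_of_real c * complex_of_real t)" for t
      define \<phi> where "\<phi> t = complex_of_real (\<psi> t) * e t" for t
      define \<phi>' where "\<phi>' t = complex_of_real (\<psi> t) * (\<i> * complex_of_real c * e t)
          + complex_of_real (\<psi>' t) * e t" for t
      have \<phi>: "bump I \<phi> \<phi>'"
        unfolding \<phi>_def[abs_def] \<phi>'_def[abs_def]
      proof (rule bump_mult[OF bump_bounded_linear[OF bounded_linear_of_real \<psi>]])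
        show "smooth e" unfolding e_def[abs_def] by (rule smooth_cexp)
        show "(e has_vector_derivative \<i> * complex_of_real c * e t) (at t)" for t
          unfolding e_def[abs_def]
          by (auto intro!: derivative_eq_intros has_vector_derivative_real_field)
      qed
      obtain \<phi>'' where \<phi>': "bump I \<phi>' \<phi>''" using bump_derivative[OF \<phi>] by blast
      have "cnj (exp (- (\<i> * complex_of_real c) * complex_of_real t)) = e t" for t
        by (simp add: e_def exp_cnj)
      then have "complex_of_real (\<psi>' t) * cinner f (V t)
          = \<phi>' t * cinner f (U t) - \<i> * complex_of_real c * (\<phi> t * cinner f (U t))" for t
        unfolding V_def cinner_scaleC_right by (simp only:) (simp add: \<phi>_def \<phi>'_def algebra_simps)
      then have eq: "(\<lambda>t. complex_of_real (\<psi>' t) * cinner f (V t))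
          = (\<lambda>t. \<phi>' t * cinner f (U t) - \<i> * complex_of_real c * (\<phi> t * cinner f (U t)))" by auto
      note int = cinner_tensor_abs(2)[OF \<phi> U(2), of f] cinner_tensor_abs(2)[OF \<phi>' U(2), of f]
      have "integrable lborel (\<lambda>t. complex_of_real (\<psi>' t) * cinner f (V t))"
        unfolding eq using int by simp
      moreover have "(LINT t|lborel. complex_of_real (\<psi>' t) * cinner f (V t)) = 0"
        unfolding eq using int osc[OF \<phi> f] U(1)
          cinner_tensor_abs(1)[OF \<phi> U(2), of f] cinner_tensor_abs(1)[OF \<phi>' U(2), of f]
        by simp
      ultimately have "(LINT t|lborel. Re (complex_of_real (\<psi>' t) * cinner f (V t))) = 0"
        by (subst integral_Re) simp_all
      then show "(LINT t|lborel. \<psi>' t * inner f (V t)) = 0" by (simp add: inner_eq_Re_cinner)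
    qed
  qed
  then have "AE t in lborel. t \<in> I \<longrightarrow> U t = 0"
    by eventually_elim (metis norm_V norm_eq_zero)
  with assms(3) U show ?thesis by (blast intro: L2_eq_zeroI)
qed

section \<open>The point spectrum of a normal extension\<close>

theorem theorem3p1:
  fixes A\<^sub>1 A\<^sub>2 :: "('h::{chilbert_space, second_countable_topology} \<times> 'h) set"
    and L\<^sub>W :: "(('h l2 \<times> 'h l2) \<times> ('h l2 \<times> 'h l2)) set"
    and a b :: real
  assumes "a < b"
    and "selfadjoint_in UNIV A\<^sub>1" and "selfadjoint_in UNIV A\<^sub>2"
    and "op_nonpos A\<^sub>1" and "op_nonneg A\<^sub>2"
    and "0 \<in> point_spectrum (op_sqrt (op_uminus A\<^sub>1)) \<inter> point_spectrum (op_sqrt A\<^sub>2)"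
    and "normal_extension_in (L2 {..<a} \<times> L2 {b<..})
           (op_direct_sum (minimal_operator A\<^sub>1 {..<a}) (minimal_operator A\<^sub>2 {b<..})) L\<^sub>W"
  shows "point_spectrum L\<^sub>W = {}"
proof -
  let ?I = "{..<a}" and ?J = "{b<..}"
  let ?X = "L2 ?I \<times> L2 ?J :: ('h l2 \<times> 'h l2) set"
  \<comment> \<open>Tensors supported in one of the two half lines suffice to generate the product space.\<close>
  define S where "S = {((z, 0), (z', 0)) | z z'. (z, z') \<in> bump_operator A\<^sub>1 ?I}
      \<union> {((0, z), (0, z')) | z z'. (z, z') \<in> bump_operator A\<^sub>2 ?J}"
  have S_left: "((z, 0), (z', 0)) \<in> S" if "(z, z') \<in> bump_operator A\<^sub>1 ?I" for z z'
    using that by (simp add: S_def)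
  have S_right: "((0, z), (0, z')) \<in> S" if "(z, z') \<in> bump_operator A\<^sub>2 ?J" for z z'
    using that by (simp add: S_def)
  have N: "formally_normal_in ?X L\<^sub>W" and sub: "S \<subseteq> L\<^sub>W"
  proof -
    have "S \<subseteq> op_direct_sum (minimal_operator A\<^sub>1 ?I) (minimal_operator A\<^sub>2 ?J)"
      using bump_operator_subset_minimal[of A\<^sub>1 ?I] bump_operator_subset_minimal[of A\<^sub>2 ?J]
        zero_in_minimal[of A\<^sub>1 ?I] zero_in_minimal[of A\<^sub>2 ?J]
      unfolding S_def op_direct_sum_def by blast
    with assms(7) show "formally_normal_in ?X L\<^sub>W" "S \<subseteq> L\<^sub>W"
      unfolding normal_extension_in_def normal_in_def by auto
  qed
  have dense: "closure (Domain A\<^sub>1) = UNIV" "closure (Domain A\<^sub>2) = UNIV"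
    using assms(2,3) unfolding selfadjoint_in_def densely_defined_in_def by auto
  have X: "v - w \<in> ?X" if "v \<in> ?X" "w \<in> ?X" for v w
    using that by (auto intro: L2_diff)
  have total: "w = 0" if w: "w \<in> ?X" and orth: "\<And>z z'. (z, z') \<in> S \<Longrightarrow> cinner z w = 0" for w
  proof -
    have "fst w = 0"
    proof (rule tensors_total[OF _ dense(1)])
      fix \<phi> \<phi>' :: "real \<Rightarrow> complex" and f assume \<phi>: "bump ?I \<phi> \<phi>'" and "f \<in> Domain A\<^sub>1"
      then obtain g where g: "(f, g) \<in> A\<^sub>1" by blast
      from orth[OF S_left[OF bump_operatorI[OF \<phi> g]]] show "cinner (tensor \<phi> f) (fst w) = 0"
        by (simp add: cinner_prod_def cinner_zero_left)
    qed (use w in auto)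
    moreover have "snd w = 0"
    proof (rule tensors_total[OF _ dense(2)])
      fix \<phi> \<phi>' :: "real \<Rightarrow> complex" and f assume \<phi>: "bump ?J \<phi> \<phi>'" and "f \<in> Domain A\<^sub>2"
      then obtain g where g: "(f, g) \<in> A\<^sub>2" by blast
      from orth[OF S_right[OF bump_operatorI[OF \<phi> g]]] show "cinner (tensor \<phi> f) (snd w) = 0"
        by (simp add: cinner_prod_def cinner_zero_left)
    qed (use w in auto)
    ultimately show ?thesis by (simp add: prod_eq_iff)
  qed
  have "u = 0" if eig: "(u, \<mu> *\<^sub>C u) \<in> L\<^sub>W" for u \<mu>
  proof -
    have u: "u \<in> ?X"
      using N eig unfolding formally_normal_in_def linear_operator_in_def by blast
    have "fst u = 0"
    proof (rule no_square_integrable_oscillation[OF disjI1[OF refl] dense(1)])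
      fix \<phi> \<phi>' :: "real \<Rightarrow> complex" and f assume \<phi>: "bump ?I \<phi> \<phi>'" and "f \<in> Domain A\<^sub>1"
      then obtain g where g: "(f, g) \<in> A\<^sub>1" by blast
      obtain \<phi>'' where \<phi>': "bump ?I \<phi>' \<phi>''" using bump_derivative[OF \<phi>] by blast
      have "cinner ((tensor \<phi>' f + tensor \<phi> g, 0) - (tensor \<phi> g - tensor \<phi>' f, 0)) u
          = 2 * \<i> * Im \<mu> * cinner (tensor \<phi> f, 0) u"
      proof (rule normal_eigenvector_identity[OF N X sub total _ _ _ eig])
        show "((tensor \<phi> f, 0), (tensor \<phi>' f + tensor \<phi> g, 0)) \<in> S"
          by (rule S_left[OF bump_operatorI[OF \<phi> g]])
        show "(tensor \<phi> g - tensor \<phi>' f, 0) \<in> ?X"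
          using tensor_in_L2[OF \<phi>, of g] tensor_in_L2[OF \<phi>', of f] u L2_diff[of "snd u" ?J "snd u"]
          by (auto intro: L2_diff)
        show "cinner z' (tensor \<phi> f, 0) = cinner z (tensor \<phi> g - tensor \<phi>' f, 0)"
          if "(z, z') \<in> S" for z z'
          using that bump_operator_formal_adjoint[OF assms(2) _ \<phi> g]
          unfolding S_def by (auto simp: cinner_prod_def cinner_zero_left cinner_zero_right)
      qed auto
      then show "cinner (tensor \<phi>' f) (fst u) = \<i> * complex_of_real (Im \<mu>) * cinner (tensor \<phi> f) (fst u)"
        by (simp add: cinner_prod_def cinner_zero_left cinner_add_left cinner_diff_left)
    qed (use u in auto)
    moreover have "snd u = 0"
    proof (rule no_square_integrable_oscillation[OF disjI2[OF refl] dense(2)])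
      fix \<phi> \<phi>' :: "real \<Rightarrow> complex" and f assume \<phi>: "bump ?J \<phi> \<phi>'" and "f \<in> Domain A\<^sub>2"
      then obtain g where g: "(f, g) \<in> A\<^sub>2" by blast
      obtain \<phi>'' where \<phi>': "bump ?J \<phi>' \<phi>''" using bump_derivative[OF \<phi>] by blast
      have "cinner ((0, tensor \<phi>' f + tensor \<phi> g) - (0, tensor \<phi> g - tensor \<phi>' f)) u
          = 2 * \<i> * Im \<mu> * cinner (0, tensor \<phi> f) u"
      proof (rule normal_eigenvector_identity[OF N X sub total _ _ _ eig])
        show "((0, tensor \<phi> f), (0, tensor \<phi>' f + tensor \<phi> g)) \<in> S"
          by (rule S_right[OF bump_operatorI[OF \<phi> g]])
        show "(0, tensor \<phi> g - tensor \<phi>' f) \<in> ?X"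
          using tensor_in_L2[OF \<phi>, of g] tensor_in_L2[OF \<phi>', of f] u L2_diff[of "fst u" ?I "fst u"]
          by (auto intro: L2_diff)
        show "cinner z' (0, tensor \<phi> f) = cinner z (0, tensor \<phi> g - tensor \<phi>' f)"
          if "(z, z') \<in> S" for z z'
          using that bump_operator_formal_adjoint[OF assms(3) _ \<phi> g]
          unfolding S_def by (auto simp: cinner_prod_def cinner_zero_left cinner_zero_right)
      qed auto
      then show "cinner (tensor \<phi>' f) (snd u) = \<i> * complex_of_real (Im \<mu>) * cinner (tensor \<phi> f) (snd u)"
        by (simp add: cinner_prod_def cinner_zero_left cinner_add_left cinner_diff_left)
    qed (use u in auto)
    ultimately show ?thesis by (simp add: prod_eq_iff)
  qed
  then show ?thesis unfolding point_spectrum_def by blast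
qed

end
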